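(* If a general compound channel (with channel state known to the receiver) is (stochastically) degraded, then its worst-case and compound capacities are the same: $$C_w=\inf_{s\in\mathcal{S}}\sup_{p(\boldsymbol{x})}\underline{I}(\boldsymbol{X};\boldsymbol{Y}|s)=\sup_{p(\boldsymbol{x})}\underline{\underline{I}}(\boldsymbol{X};\boldsymbol{Y})=C_c.$$
   Context: A general compound channel is, for each blocklength $n$ and each state $s$ in an arbitrary set $\mathcal{S}$, a transition probability $p_s(y^n|x^n)$ (no stationarity, ergodicity or information stability; arbitrary alphabets, sums replaced by integrals if not discrete). The state is known to the receiver but not the transmitter and is independent of the input. An input is a sequence $\boldsymbol{X}=\{X^n\}_{n=1}^\infty$ with arbitrary distributions $p(x^n)$ (collectively $p(\boldsymbol{x})$), not depending on $s$; $Y^n$ is the output under state $s$ with distribution $p_s(y^n)$. Let $i(x^n;y^n|s)=\ln\frac{p_s(y^n|x^n)}{p_s(y^n)}$, $Z_{ns}=\frac1n i(X^n;Y^n|s)$, and $$\underline{I}(\boldsymbol{X};\boldsymbol{Y}|s)=\sup\{R:\lim_{n\to\infty}\Pr\{Z_{ns}\le R\}=0\},\quad\underline{\underline{I}}(\boldsymbol{X};\boldsymbol{Y})=\sup\{R:\lim_{n\to\infty}\sup_{s\in\mathcal{S}}\Pr\{Z_{ns}\le R\}=0\}.$$ The worst-case capacity is $C_w=\inf_{s\in\mathcal{S}}\sup_{p(\boldsymbol{x})}\underline{I}(\boldsymbol{X};\boldsymbol{Y}|s)$, where $\sup_{p(\boldsymbol{x})}\underline{I}(\boldsymbol{X};\boldsymbol{Y}|s)$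 is the capacity of the single channel with known state $s$. The compound capacity $C_c$ is the supremum of rates $R$ for which there is a sequence of codes (codewords not depending on $s$, decision regions possibly depending on $s$, rate $r_n=\frac1n\ln M_n$ with $M_n$ codewords) with $\liminf r_n\ge R$ and $\sup_{s\in\mathcal{S}}\varepsilon_{ns}\to0$, $\varepsilon_{ns}$ being the error probability under state $s$; it equals $\sup_{p(\boldsymbol{x})}\underline{\underline{I}}(\boldsymbol{X};\boldsymbol{Y})$. A compound channel is (stochastically) degraded if there is a state $s_w\in\mathcal{S}$ which is degraded with respect to every other state $s\in\mathcal{S}$: for every $n$ and $s$ there is a channel $q_s(y^n_{s_w}|y^n_s)$ such that $p_{s_w}(y^n_{s_w}|x^n)=\sum_{y^n_s}p_s(y^n_s|x^n)\,q_s(y^n_{s_w}|y^n_s)$ (e.g. if $X^n\to Y^n_s\to Y^n_{s_w}$ is a Markov chain for any $s$ and $n$). *)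

theory Defs
  imports "HOL-Probability.Probability"
begin

text \<open>
  Words of length \<open>n\<close> over an alphabet \<open>A\<close>, indexed by \<open>1, ..., n\<close>. An alphabet is an arbitrary
  nonempty measurable space; only the space and the sigma-algebra of \<open>A\<close> are used. A finite or
  countable alphabet is a count space, a continuous one is \<open>borel\<close>, etc.
\<close>

definition block :: "'a measure \<Rightarrow> nat \<Rightarrow> (nat \<Rightarrow> 'a) measure" where
  "block A n = (\<Pi>\<^sub>M i\<in>{1..n}. A)"

text \<open>
  \<open>W s n x\<close> is the law of the output word under state \<open>s\<close> when the word \<open>x\<close> of length \<open>n\<close> is sent.
  Apart from measurability in \<open>x\<close> nothing is assumed of it; in particular the laws for different
  \<open>n\<close> need not be related.
\<close>

locale compound_channel =
  fixes A :: "'a measure" and B :: "'b measure" and S :: "'s set"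
    and W :: "'s \<Rightarrow> nat \<Rightarrow> (nat \<Rightarrow> 'a) \<Rightarrow> (nat \<Rightarrow> 'b) measure"
  assumes input_alphabet_nonempty: "space A \<noteq> {}"
    and output_alphabet_nonempty: "space B \<noteq> {}"
    and states_nonempty: "S \<noteq> {}"
    and kernel: "\<And>s n. s \<in> S \<Longrightarrow> n \<ge> 1 \<Longrightarrow> W s n \<in> block A n \<rightarrow>\<^sub>M prob_algebra (block B n)"

text \<open>
  The \<open>q\<close> below is the degrading channel; its Kleisli composition with \<open>W s n\<close> is the integral
  version of \<open>\<Sum>y. p\<^sub>s(y|x) q\<^sub>s(y'|y)\<close>.
\<close>

definition degraded ::
  "'a measure \<Rightarrow> 'b measure \<Rightarrow> 's set \<Rightarrow>
   ('s \<Rightarrow> nat \<Rightarrow> (nat \<Rightarrow> 'a) \<Rightarrow> (nat \<Rightarrow> 'b) measure) \<Rightarrow> bool" where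
  "degraded A B S W \<longleftrightarrow>
     (\<exists>sw\<in>S. \<forall>s\<in>S - {sw}. \<forall>n\<ge>1.
        \<exists>q \<in> block B n \<rightarrow>\<^sub>M prob_algebra (block B n).
          \<forall>x\<in>space (block A n). W sw n x = W s n x \<bind> q)"

text \<open>
  The input distributions for different blocklengths are not required to be consistent.
\<close>

definition inputs :: "'a measure \<Rightarrow> (nat \<Rightarrow> (nat \<Rightarrow> 'a) measure) set" where
  "inputs A = {P. \<forall>n\<ge>1. P n \<in> space (prob_algebra (block A n))}"

definition joint_law ::
  "'a measure \<Rightarrow> 'b measure \<Rightarrow> ('a \<Rightarrow> 'b measure) \<Rightarrow> 'a measure \<Rightarrow> ('a \<times> 'b) measure" where
  "joint_law X Y K P = P \<bind> (\<lambda>x. K x \<bind> (\<lambda>y. return (X \<Otimes>\<^sub>M Y) (x, y)))"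

definition ln_ennreal :: "ennreal \<Rightarrow> ereal" where
  "ln_ennreal r =
     (if r = 0 then -\<infinity> else if r = \<infinity> then \<infinity> else ereal (ln (enn2real r)))"

text \<open>
  \<open>log_lr P Q\<close> is the logarithm of the derivative of \<open>P\<close> with respect to \<open>Q\<close>, with the value
  \<open>\<infinity>\<close> where \<open>P\<close> is singular to \<open>Q\<close>. \<open>RN_deriv Q P\<close> cannot be used directly, because it is
  identically 0 if \<open>P\<close> is not absolutely continuous with respect to \<open>Q\<close>; hence both measures are
  differentiated with respect to the dominating measure \<open>P + Q\<close>.
\<close>

definition measure_plus :: "'a measure \<Rightarrow> 'a measure \<Rightarrow> 'a measure" where
  "measure_plus P Q = measure_of (space P) (sets P) (\<lambda>E. emeasure P E + emeasure Q E)"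

definition log_lr :: "'a measure \<Rightarrow> 'a measure \<Rightarrow> 'a \<Rightarrow> ereal" where
  "log_lr P Q z =
     ln_ennreal (RN_deriv (measure_plus P Q) P z / RN_deriv (measure_plus P Q) Q z)"

text \<open>
  For arbitrary alphabets \<open>ln (p(y|x) / p(y))\<close> is the log-derivative of the joint law of input and
  output with respect to the product of its marginals. Differentiating jointly, rather than
  separately for every \<open>x\<close>, makes it measurable in \<open>(x, y)\<close>. The lemma \<open>info_density_eq\<close> below
  recovers the quotient of densities.
\<close>

definition info_density ::
  "'a measure \<Rightarrow> 'b measure \<Rightarrow> ('a \<Rightarrow> 'b measure) \<Rightarrow> 'a measure \<Rightarrow> 'a \<times> 'b \<Rightarrow> ereal" where
  "info_density X Y K P = log_lr (joint_law X Y K P) (P \<Otimes>\<^sub>M (P \<bind> K))"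

definition prob_Z_le ::
  "'a measure \<Rightarrow> 'b measure \<Rightarrow> ('s \<Rightarrow> nat \<Rightarrow> (nat \<Rightarrow> 'a) \<Rightarrow> (nat \<Rightarrow> 'b) measure) \<Rightarrow>
   (nat \<Rightarrow> (nat \<Rightarrow> 'a) measure) \<Rightarrow> 's \<Rightarrow> nat \<Rightarrow> real \<Rightarrow> real" where
  "prob_Z_le A B W P s n R =
     \<P>(z in joint_law (block A n) (block B n) (W s n) (P n).
        info_density (block A n) (block B n) (W s n) (P n) z / ereal (real n) \<le> ereal R)"

definition inf_info_rate ::
  "'a measure \<Rightarrow> 'b measure \<Rightarrow> ('s \<Rightarrow> nat \<Rightarrow> (nat \<Rightarrow> 'a) \<Rightarrow> (nat \<Rightarrow> 'b) measure) \<Rightarrow>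
   (nat \<Rightarrow> (nat \<Rightarrow> 'a) measure) \<Rightarrow> 's \<Rightarrow> ereal" where
  "inf_info_rate A B W P s =
     Sup (ereal ` {R. (\<lambda>n. prob_Z_le A B W P s n R) \<longlonglongrightarrow> 0})"

definition compound_inf_info_rate ::
  "'a measure \<Rightarrow> 'b measure \<Rightarrow> 's set \<Rightarrow>
   ('s \<Rightarrow> nat \<Rightarrow> (nat \<Rightarrow> 'a) \<Rightarrow> (nat \<Rightarrow> 'b) measure) \<Rightarrow>
   (nat \<Rightarrow> (nat \<Rightarrow> 'a) measure) \<Rightarrow> ereal" where
  "compound_inf_info_rate A B S W P =
     Sup (ereal ` {R. (\<lambda>n. SUP s\<in>S. prob_Z_le A B W P s n R) \<longlonglongrightarrow> 0})"

definition worst_case_capacity ::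
  "'a measure \<Rightarrow> 'b measure \<Rightarrow> 's set \<Rightarrow>
   ('s \<Rightarrow> nat \<Rightarrow> (nat \<Rightarrow> 'a) \<Rightarrow> (nat \<Rightarrow> 'b) measure) \<Rightarrow> ereal" where
  "worst_case_capacity A B S W = (INF s\<in>S. SUP P\<in>inputs A. inf_info_rate A B W P s)"

text \<open>
  A code for blocklength \<open>n\<close> with \<open>M\<close> equiprobable messages, codewords \<open>c m\<close> and decision regions
  \<open>D s m\<close>; outputs outside all decision regions are decoding errors.
\<close>

definition is_code ::
  "'a measure \<Rightarrow> 'b measure \<Rightarrow> 's set \<Rightarrow> nat \<Rightarrow> nat \<Rightarrow> (nat \<Rightarrow> (nat \<Rightarrow> 'a)) \<Rightarrow>
   ('s \<Rightarrow> nat \<Rightarrow> (nat \<Rightarrow> 'b) set) \<Rightarrow> bool" where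
  "is_code A B S n M c D \<longleftrightarrow>
     M \<ge> 1 \<and> (\<forall>m<M. c m \<in> space (block A n)) \<and>
     (\<forall>s\<in>S. (\<forall>m<M. D s m \<in> sets (block B n)) \<and> disjoint_family_on (D s) {..<M})"

definition error_prob ::
  "'b measure \<Rightarrow> ('s \<Rightarrow> nat \<Rightarrow> (nat \<Rightarrow> 'a) \<Rightarrow> (nat \<Rightarrow> 'b) measure) \<Rightarrow> 's \<Rightarrow> nat \<Rightarrow> nat \<Rightarrow>
   (nat \<Rightarrow> (nat \<Rightarrow> 'a)) \<Rightarrow> ('s \<Rightarrow> nat \<Rightarrow> (nat \<Rightarrow> 'b) set) \<Rightarrow> real" where
  "error_prob B W s n M c D =
     (\<Sum>m<M. measure (W s n (c m)) (space (block B n) - D s m)) / real M"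

definition achievable ::
  "'a measure \<Rightarrow> 'b measure \<Rightarrow> 's set \<Rightarrow>
   ('s \<Rightarrow> nat \<Rightarrow> (nat \<Rightarrow> 'a) \<Rightarrow> (nat \<Rightarrow> 'b) measure) \<Rightarrow> real \<Rightarrow> bool" where
  "achievable A B S W R \<longleftrightarrow>
     (\<exists>M c D. (\<forall>n\<ge>1. is_code A B S n (M n) (c n) (D n)) \<and>
        ereal R \<le> liminf (\<lambda>n. ereal (ln (real (M n)) / real n)) \<and>
        (\<lambda>n. SUP s\<in>S. error_prob B W s n (M n) (c n) (D n)) \<longlonglongrightarrow> 0)"

definition compound_capacity ::
  "'a measure \<Rightarrow> 'b measure \<Rightarrow> 's set \<Rightarrow>
   ('s \<Rightarrow> nat \<Rightarrow> (nat \<Rightarrow> 'a) \<Rightarrow> (nat \<Rightarrow> 'b) measure) \<Rightarrow> ereal" where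
  "compound_capacity A B S W = Sup (ereal ` {R. achievable A B S W R})"

lemma sets_measure_plus [simp]: "sets (measure_plus P Q) = sets P"
  and space_measure_plus [simp]: "space (measure_plus P Q) = space P"
  by (simp_all add: measure_plus_def)

lemma emeasure_measure_plus:
  assumes "sets P = sets Q" "E \<in> sets P"
  shows "emeasure (measure_plus P Q) E = emeasure P E + emeasure Q E"
  unfolding measure_plus_def
proof (rule emeasure_measure_of_sigma[OF _ _ _ assms(2)])
  show "sigma_algebra (space P) (sets P)" ..
  show "positive (sets P) (\<lambda>E. emeasure P E + emeasure Q E)"
    by (simp add: positive_def)
  show "countably_additive (sets P) (\<lambda>E. emeasure P E + emeasure Q E)"
  proof (rule countably_additiveI)
    fix F :: "nat \<Rightarrow> _"
    assume F: "range F \<subseteq> sets P" "disjoint_family F" "(\<Union>i. F i) \<in> sets P"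
    then have "(\<Sum>i. emeasure P (F i) + emeasure Q (F i))
        = (\<Sum>i. emeasure P (F i)) + (\<Sum>i. emeasure Q (F i))"
      by (intro suminf_add[symmetric]) auto
    also have "\<dots> = emeasure P (\<Union>i. F i) + emeasure Q (\<Union>i. F i)"
      using F assms(1) by (simp add: suminf_emeasure)
    finally show "(\<Sum>i. emeasure P (F i) + emeasure Q (F i))
        = emeasure P (\<Union>i. F i) + emeasure Q (\<Union>i. F i)" .
  qed
qed

lemma log_lr_density:
  assumes L: "sigma_finite_measure L"
    and [measurable]: "p \<in> borel_measurable L" "q \<in> borel_measurable L"
    and "finite_measure (density L p)" "finite_measure (density L q)"
  shows "AE z in density L p. log_lr (density L p) (density L q) z = ln_ennreal (p z / q z)"
proof -
  interpret L: sigma_finite_measure L by fact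
  let ?P = "density L p" and ?Q = "density L q"
  let ?m = "measure_plus ?P ?Q"
  interpret P: finite_measure ?P by fact
  interpret Q: finite_measure ?Q by fact
  have m: "?m = density L (\<lambda>z. p z + q z)"
    by (rule measure_eqI)
       (simp_all add: emeasure_measure_plus emeasure_density nn_integral_add distrib_right)
  have fin: "finite_measure ?m"
    by (rule finite_measureI)
       (use P.finite_emeasure_space Q.finite_emeasure_space in \<open>simp add: emeasure_measure_plus\<close>)
  interpret m: finite_measure ?m by (rule fin)
  have eq: "AE z in L. (p z + q z) * RN_deriv ?m (density L r) z = r z"
    if [measurable]: "r \<in> borel_measurable L" and r: "r = p \<or> r = q" for r
  proof -
    have fr: "finite_measure (density L r)" using r assms(4,5) by auto
    have "absolutely_continuous ?m (density L r)"
      unfolding absolutely_continuous_def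
    proof
      fix E assume "E \<in> null_sets ?m"
      then show "E \<in> null_sets (density L r)"
        using r by (auto simp: null_sets_def emeasure_measure_plus)
    qed
    then have "density ?m (RN_deriv ?m (density L r)) = density L r"
      by (intro m.density_RN_deriv) auto
    moreover have [measurable]: "RN_deriv ?m (density L r) \<in> borel_measurable L"
      using borel_measurable_RN_deriv[of ?m "density L r"]
      by (simp add: measurable_def)
    ultimately have e: "density L (\<lambda>z. (p z + q z) * RN_deriv ?m (density L r) z) = density L r"
      unfolding m by (subst (asm) density_density_eq) auto
    have "AE z in L. (p z + q z) * RN_deriv ?m (density L r) z = r z"
      by (rule L.density_unique[OF _ _ e]) auto
    then show ?thesis .
  qed
  have fin_AE: "AE z in L. r z \<noteq> \<infinity>"
    if [measurable]: "r \<in> borel_measurable L" and "finite_measure (density L r)" for r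
  proof (rule nn_integral_PInf_AE)
    have "emeasure (density L r) (space L) \<noteq> \<infinity>"
      using finite_measure.finite_emeasure_space[OF that(2)] by simp
    also have "emeasure (density L r) (space L) = integral\<^sup>N L r"
      by (simp add: emeasure_density cong: nn_integral_cong)
    finally show "integral\<^sup>N L r \<noteq> \<infinity>" .
  qed auto
  have "AE z in L. 0 < p z \<longrightarrow> log_lr ?P ?Q z = ln_ennreal (p z / q z)"
    using eq[of p, simplified] eq[of q, simplified] fin_AE[OF assms(2,4)] fin_AE[OF assms(3,5)]
  proof eventually_elim
    case (elim z)
    define a b c where "a = RN_deriv ?m ?P z" and "b = RN_deriv ?m ?Q z" and "c = p z + q z"
    have "p z = c * a" "q z = c * b" and c: "c \<noteq> \<infinity>"
      using elim by (auto simp: a_def b_def c_def)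
    then have "a / b = p z / q z" if "0 < p z"
      using that divide_mult_eq[of c a b] by (cases "c = 0") (auto simp: mult.commute)
    then show ?case by (auto simp: log_lr_def a_def b_def)
  qed
  then show ?thesis by (simp add: AE_density)
qed

lemma info_density_eq:
  assumes L: "sigma_finite_measure L" "sets L = sets Y"
    and P: "P \<in> space (prob_algebra X)" and K: "K \<in> X \<rightarrow>\<^sub>M prob_algebra Y"
    and p [measurable]: "(\<lambda>(x, y). p x y) \<in> borel_measurable (X \<Otimes>\<^sub>M Y)"
    and Kp: "\<And>x. x \<in> space X \<Longrightarrow> K x = density L (p x)"
  shows "AE (x, y) in joint_law X Y K P.
           info_density X Y K P (x, y) = ln_ennreal (p x y / (\<integral>\<^sup>+x'. p x' y \<partial>P))"
proof -
  let ?J = "joint_law X Y K P" and ?g = "\<lambda>y. \<integral>\<^sup>+x'. p x' y \<partial>P"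
  have sP [measurable_cong]: "sets P = sets X" and pP: "prob_space P"
    using P by (auto simp: space_prob_algebra)
  interpret P: prob_space P by fact
  interpret L: sigma_finite_measure L by fact
  interpret PL: pair_sigma_finite P L ..
  note L(2) [measurable_cong]
  have spP: "space P = space X" using sP by (rule sets_eq_imp_space_eq)
  have spL: "space L = space Y" using L(2) by (rule sets_eq_imp_space_eq)
  have K' [measurable]: "K \<in> X \<rightarrow>\<^sub>M subprob_algebra Y"
    using K by (rule measurable_prob_algebraD)
  have Ks: "sets (K x) = sets Y" "prob_space (K x)" if "x \<in> space X" for x
    using measurable_space[OF K that] by (auto simp: space_prob_algebra)
  have in1 [measurable]:
    "(\<lambda>x. K x \<bind> (\<lambda>y. return (X \<Otimes>\<^sub>M Y) (x, y))) \<in> X \<rightarrow>\<^sub>M subprob_algebra (X \<Otimes>\<^sub>M Y)"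
    by measurable
  have PK: "prob_space (P \<bind> K)"
    by (rule prob_space_bind'[OF P K])
  have sPK: "sets (P \<bind> K) = sets Y"
    by (rule sets_bind'[OF P K])
  have gm [measurable]: "?g \<in> borel_measurable Y"
    by measurable
  have J: "?J = density (P \<Otimes>\<^sub>M L) (\<lambda>(x, y). p x y)"
  proof (rule measure_eqI)
    have "sets ?J = sets (X \<Otimes>\<^sub>M Y)"
      unfolding joint_law_def
      by (rule sets_bind[OF _ P.not_empty])
         (use sets_kernel[OF in1] spP in auto)
    also have "\<dots> = sets (P \<Otimes>\<^sub>M L)"
      by (rule sets_pair_measure_cong) (use sP L in auto)
    finally show "sets ?J = sets (density (P \<Otimes>\<^sub>M L) (\<lambda>(x, y). p x y))" by simp
    fix E assume "E \<in> sets ?J"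
    with \<open>sets ?J = sets (X \<Otimes>\<^sub>M Y)\<close> have E [measurable]: "E \<in> sets (X \<Otimes>\<^sub>M Y)" by simp
    have "emeasure ?J E =
        (\<integral>\<^sup>+x. emeasure (K x \<bind> (\<lambda>y. return (X \<Otimes>\<^sub>M Y) (x, y))) E \<partial>P)"
      unfolding joint_law_def by (rule emeasure_bind[OF P.not_empty _ E]) measurable
    also have "\<dots> = (\<integral>\<^sup>+x. \<integral>\<^sup>+y. p x y * indicator E (x, y) \<partial>L \<partial>P)"
    proof (rule nn_integral_cong)
      fix x assume "x \<in> space P"
      then have x: "x \<in> space X" by (simp add: spP)
      have "emeasure (K x \<bind> (\<lambda>y. return (X \<Otimes>\<^sub>M Y) (x, y))) E
          = (\<integral>\<^sup>+y. emeasure (return (X \<Otimes>\<^sub>M Y) (x, y)) E \<partial>K x)"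
        by (rule emeasure_bind[OF prob_space.not_empty[OF Ks(2)[OF x]] _ E])
           (use x in \<open>simp add: measurable_cong_sets[OF Ks(1)[OF x] refl]\<close>)
      also have "\<dots> = (\<integral>\<^sup>+y. indicator E (x, y) \<partial>density L (p x))"
        using x by (simp add: Kp[OF x])
      also have "\<dots> = (\<integral>\<^sup>+y. p x y * indicator E (x, y) \<partial>L)"
        by (rule nn_integral_density) (use x in measurable)
      finally show "emeasure (K x \<bind> (\<lambda>y. return (X \<Otimes>\<^sub>M Y) (x, y))) E
          = (\<integral>\<^sup>+y. p x y * indicator E (x, y) \<partial>L)" .
    qed
    also have "\<dots> = emeasure (density (P \<Otimes>\<^sub>M L) (\<lambda>(x, y). p x y)) E"
      by (simp add: emeasure_density L.nn_integral_fst[symmetric] split_beta')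
    finally show "emeasure ?J E = emeasure (density (P \<Otimes>\<^sub>M L) (\<lambda>(x, y). p x y)) E" .
  qed
  have out: "P \<bind> K = density L ?g"
  proof (rule measure_eqI)
    show "sets (P \<bind> K) = sets (density L ?g)" using sPK L by simp
    fix E assume "E \<in> sets (P \<bind> K)"
    then have E [measurable]: "E \<in> sets Y" by (simp add: sPK)
    have "emeasure (P \<bind> K) E = (\<integral>\<^sup>+x. emeasure (K x) E \<partial>P)"
      by (rule emeasure_bind[OF P.not_empty _ E]) measurable
    also have "\<dots> = (\<integral>\<^sup>+x. \<integral>\<^sup>+y. p x y * indicator E y \<partial>L \<partial>P)"
      by (rule nn_integral_cong) (simp add: spP Kp emeasure_density)
    also have "\<dots> = (\<integral>\<^sup>+y. \<integral>\<^sup>+x. p x y * indicator E y \<partial>P \<partial>L)"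
      by (rule PL.Fubini'[symmetric]) measurable
    also have "\<dots> = emeasure (density L ?g) E"
      by (subst emeasure_density) (auto simp: spL nn_integral_multc intro!: nn_integral_cong)
    finally show "emeasure (P \<bind> K) E = emeasure (density L ?g) E" .
  qed
  have "P \<Otimes>\<^sub>M (P \<bind> K) = density P (\<lambda>_. 1) \<Otimes>\<^sub>M density L ?g"
    by (simp add: out density_1)
  also have "\<dots> = density (P \<Otimes>\<^sub>M L) (\<lambda>(x, y). 1 * ?g y)"
    by (rule pair_measure_density)
       (use PK L.sigma_finite_measure_axioms in
         \<open>auto simp: out intro: prob_space_imp_sigma_finite\<close>)
  finally have Q: "P \<Otimes>\<^sub>M (P \<bind> K) = density (P \<Otimes>\<^sub>M L) (\<lambda>(x, y). ?g y)" by simp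
  have "prob_space ?J"
    unfolding joint_law_def
  proof (rule P.prob_space_bind[OF AE_I2])
    fix x assume "x \<in> space P"
    then have x: "x \<in> space X" by (simp add: spP)
    interpret Kx: prob_space "K x" using Ks(2)[OF x] .
    show "prob_space (K x \<bind> (\<lambda>y. return (X \<Otimes>\<^sub>M Y) (x, y)))"
      by (rule Kx.prob_space_bind[where S="X \<Otimes>\<^sub>M Y", OF AE_I2])
         (use x in \<open>auto simp: measurable_cong_sets[OF Ks(1)[OF x] refl]
            sets_eq_imp_space_eq[OF Ks(1)[OF x]] space_pair_measure intro!: prob_space_return\<close>)
  qed measurable
  moreover have "prob_space (P \<Otimes>\<^sub>M (P \<bind> K))"
    by (rule prob_space_pair[OF pP PK])
  ultimately have "AE z in ?J. info_density X Y K P z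
      = ln_ennreal ((case z of (x, y) \<Rightarrow> p x y) / (case z of (x, y) \<Rightarrow> ?g y))"
    unfolding info_density_def J Q
    by (intro log_lr_density) (auto intro: prob_space.finite_measure PL.sigma_finite_measure_axioms)
  then show ?thesis by (simp add: case_prod_unfold)
qed

end

(*
  Let sw be the degraded state and C = sup_P I(P; sw), the capacity of its channel. All the
  quantities in the statement equal C.

  Everything rests on a dichotomy for the information density i = ln dJ/dQ of the joint law J
  against the product Q of its marginals: J <= e^t Q on {i <= t} and e^t Q <= J on {i > t}.

  * Data processing: using the event {i_sw > t} as a test for the output of another state s,
    randomised by the degrading channel, gives Pr{i_s <= t - u} <= Pr{i_sw <= t} + e^(-u),
    uniformly in s. Hence the compound inf-information rate of any input is at least its rate
    under sw, and the opposite inequality is trivial.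
  * C_c <= C is the Verdu-Han converse for sw alone, with the input uniform on the codewords.
  * C <= C_c: Feinstein's greedy construction gives good codes for sw. In a state s the receiver
    could degrade its output and decode as for sw; this is a randomised decoder for s, and
    maximum likelihood regions do at least as well. The same codewords thus serve all states.
*)
theory Submission
  imports Defs
begin

section \<open>Thresholding the log-likelihood ratio\<close>

lemma ln_ennreal_le_iff: "ln_ennreal r \<le> ereal t \<longleftrightarrow> r \<le> ennreal (exp t)"
proof (cases r)
  case (real x)
  then show ?thesis
    by (cases "x = 0") (auto simp: ln_ennreal_def, (metis exp_le_cancel_iff exp_ln less_eq_real_def)+)
qed (auto simp: ln_ennreal_def top_unique)

lemma ennreal_divide_le_imp:
  fixes a b c :: ennreal
  assumes le: "a / b \<le> c" and c: "c \<noteq> 0" "c \<noteq> \<infinity>"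
  shows "a \<le> c * b"
proof (cases "b = 0 \<or> b = \<infinity>")
  \<comment> \<open>Degenerate denominators: for \<open>b = 0\<close> the quotient is infinite
    unless \<open>a = 0\<close>, which finiteness of \<open>c\<close> enforces; for
    \<open>b = \<infinity>\<close> the right-hand side is infinite because \<open>c\<close> is
    nonzero.\<close>
  case True
  then show ?thesis
    using le c by (cases "a = 0") (auto simp: ennreal_mult_top top_unique)
next
  case False
  then have "a = a / b * b"
    by (simp add: ennreal_divide_times less_top[symmetric] zero_less_iff_neq_zero)
  also have "\<dots> \<le> c * b"
    by (intro mult_right_mono le) simp
  finally show ?thesis .
qed

lemma ennreal_less_divide_imp:
  fixes a b c :: ennreal
  assumes "c < a / b" shows "c * b \<le> a"
  using assms
  by (metis Groups.mult_ac(2) divide_le_posI_ennreal ennreal_zero_less_mult_iff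
      linorder_linear linorder_not_less zero_order(2))

text \<open>With \<open>a\<close> and \<open>b\<close> the densities of \<open>J\<close> and
  \<open>Q\<close> with respect to \<open>J + Q\<close>, the threshold on \<open>log_lr\<close> says
  \<open>a \<le> exp t * b\<close> on \<open>L\<close> and \<open>exp t * b \<le> a\<close> off
  \<open>L\<close>; both bounds follow by integration. Where \<open>b\<close> vanishes but
  \<open>a\<close> does not, the ratio is infinite and the point lies off \<open>L\<close>. The
  weight \<open>f\<close> admits randomised tests as well as events.\<close>

lemma log_lr_dichotomy:
  fixes t :: real
  assumes J: "finite_measure J" and Q: "finite_measure Q" and s: "sets J = sets Q"
  assumes f [measurable]: "f \<in> borel_measurable J"
  defines "L \<equiv> {z \<in> space J. log_lr J Q z \<le> ereal t}"
  shows "L \<in> sets J"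
    and "(\<integral>\<^sup>+z. f z * indicator L z \<partial>J) \<le> exp t * (\<integral>\<^sup>+z. f z * indicator L z \<partial>Q)"
    and "exp t * (\<integral>\<^sup>+z. f z * indicator (space J - L) z \<partial>Q) \<le> (\<integral>\<^sup>+z. f z * indicator (space J - L) z \<partial>J)"
proof -
  interpret J: finite_measure J by fact
  interpret Q: finite_measure Q by fact
  let ?m = "measure_plus J Q"
  define a where "a = RN_deriv ?m J"
  define b where "b = RN_deriv ?m Q"
  have fin: "finite_measure ?m"
    by (rule finite_measureI)
       (use J.finite_emeasure_space Q.finite_emeasure_space sets_eq_imp_space_eq[OF s] in \<open>simp add: emeasure_measure_plus s\<close>)
  interpret m: finite_measure ?m by (rule fin)
  have sm: "sets ?m = sets J" by simp
  note s[symmetric, measurable_cong] sm [measurable_cong]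
  have [measurable]: "a \<in> borel_measurable J" "b \<in> borel_measurable J"
    using borel_measurable_RN_deriv[of ?m J] borel_measurable_RN_deriv[of ?m Q]
    by (simp_all add: a_def b_def measurable_def)
  have L: "L = {z \<in> space J. a z / b z \<le> ennreal (exp t)}"
    unfolding L_def log_lr_def ln_ennreal_le_iff a_def b_def ..
  show [measurable]: "L \<in> sets J" unfolding L by measurable
  have ac: "absolutely_continuous ?m J" "absolutely_continuous ?m Q"
    unfolding absolutely_continuous_def by (auto simp: null_sets_def emeasure_measure_plus s)
  have dJ: "density ?m a = J" and dQ: "density ?m b = Q"
    unfolding a_def b_def by (intro m.density_RN_deriv ac; simp add: s)+
  \<comment> \<open>Both integrals are moved to the common dominating measure, so that only a
    pointwise comparison of integrands is left.\<close>
  have nJ: "(\<integral>\<^sup>+z. g z \<partial>J) = (\<integral>\<^sup>+z. a z * g z \<partial>?m)"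
    and nQ: "(\<integral>\<^sup>+z. g z \<partial>Q) = (\<integral>\<^sup>+z. b z * g z \<partial>?m)"
    if [measurable]: "g \<in> borel_measurable J" for g
    by (subst dJ[symmetric] dQ[symmetric], subst nn_integral_density; simp)+
  show "(\<integral>\<^sup>+z. f z * indicator L z \<partial>J) \<le> exp t * (\<integral>\<^sup>+z. f z * indicator L z \<partial>Q)"
    by (simp add: nJ nQ flip: nn_integral_cmult, rule nn_integral_mono)
       (auto simp: L indicator_def dest!: ennreal_divide_le_imp intro: mult_right_mono simp flip: mult.assoc)
  show "exp t * (\<integral>\<^sup>+z. f z * indicator (space J - L) z \<partial>Q) \<le> (\<integral>\<^sup>+z. f z * indicator (space J - L) z \<partial>J)"
    by (simp add: nJ nQ flip: nn_integral_cmult, rule nn_integral_mono)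
       (auto simp: L indicator_def not_le dest!: ennreal_less_divide_imp
          intro: mult_right_mono simp flip: mult.assoc)
qed

text \<open>Turns a bound averaged over every set of inputs into a bound at almost every input: if
  it failed, the set where \<open>g\<close> exceeds \<open>c\<close> would be a test set violating
  the averaged bound.\<close>

lemma AE_le_const_of_set_integral_le:
  fixes g :: "'a \<Rightarrow> ennreal" and c :: ennreal
  assumes P: "finite_measure P" and [measurable]: "g \<in> borel_measurable P" and c: "c < \<infinity>"
    and le: "\<And>G. G \<in> sets P \<Longrightarrow> (\<integral>\<^sup>+x. g x * indicator G x \<partial>P) \<le> c * emeasure P G"
  shows "AE x in P. g x \<le> c"
proof (rule ccontr)
  interpret finite_measure P by fact
  assume n: "\<not> (AE x in P. g x \<le> c)"
  define G where "G = {x\<in>space P. c < g x}"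
  have [measurable]: "G \<in> sets P" unfolding G_def by measurable
  have cG: "(\<integral>\<^sup>+x. c * indicator G x \<partial>P) = c * emeasure P G"
    by (simp add: nn_integral_cmult_indicator)
  have "(\<integral>\<^sup>+x. c * indicator G x \<partial>P) < (\<integral>\<^sup>+x. g x * indicator G x \<partial>P)"
  proof (rule nn_integral_less)
    \<comment> \<open>A strict inequality between integrals requires the smaller one to be
      finite.\<close>
    show "(\<integral>\<^sup>+x. c * indicator G x \<partial>P) \<noteq> \<infinity>"
      unfolding cG using c by (simp add: ennreal_mult_eq_top_iff less_top[symmetric])
    show "AE x in P. c * indicator G x \<le> g x * indicator G x"
      by (auto simp: G_def indicator_def)
    have "AE x in P. g x \<le> c" if "AE x in P. g x * indicator G x \<le> c * indicator G x"
      using that AE_space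
    proof eventually_elim
      case (elim x)
      then show ?case by (cases "c < g x") (auto simp: G_def)
    qed
    with n show "\<not> (AE x in P. g x * indicator G x \<le> c * indicator G x)" by blast
  qed measurable
  with le[of G] cG show False by simp
qed

section \<open>The information density of an input\<close>

text \<open>The one-shot setting: one input law and one channel. Blocklength \<open>n\<close> under
  state \<open>s\<close> is the instance with block spaces, \<open>W s n\<close> and
  \<open>P n\<close>.\<close>

locale channel_input =
  fixes X :: "'a measure" and Y :: "'b measure" and K :: "'a \<Rightarrow> 'b measure" and P :: "'a measure"
  assumes P: "P \<in> space (prob_algebra X)" and K: "K \<in> X \<rightarrow>\<^sub>M prob_algebra Y"
begin

abbreviation "J \<equiv> joint_law X Y K P"
abbreviation "Q \<equiv> P \<Otimes>\<^sub>M (P \<bind> K)"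

text \<open>For \<open>t = n * R\<close> the \<open>J\<close>-probability of this event is the
  probability that the normalised information density is at most \<open>R\<close>.\<close>

definition low :: "real \<Rightarrow> ('a \<times> 'b) set" where
  "low t = {z \<in> space (X \<Otimes>\<^sub>M Y). info_density X Y K P z \<le> ereal t}"

lemma sets_P [simp, measurable_cong]: "sets P = sets X"
  and prob_P: "prob_space P"
  using P by (auto simp: space_prob_algebra)

lemma space_P [simp]: "space P = space X"
  by (rule sets_eq_imp_space_eq) simp

lemma K_subprob [measurable]: "K \<in> X \<rightarrow>\<^sub>M subprob_algebra Y"
  using K by (rule measurable_prob_algebraD)

lemma sets_K [simp]: "x \<in> space X \<Longrightarrow> sets (K x) = sets Y"
  and prob_K: "x \<in> space X \<Longrightarrow> prob_space (K x)"
  using measurable_space[OF K] by (auto simp: space_prob_algebra)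

lemma space_K [simp]: "x \<in> space X \<Longrightarrow> space (K x) = space Y"
  by (rule sets_eq_imp_space_eq) simp

lemma sets_PK [simp, measurable_cong]: "sets (P \<bind> K) = sets Y"
  and prob_PK: "prob_space (P \<bind> K)"
  using sets_bind'[OF P K] prob_space_bind'[OF P K] .

lemma space_PK [simp]: "space (P \<bind> K) = space Y"
  by (rule sets_eq_imp_space_eq) simp

lemma sets_Q [simp, measurable_cong]: "sets Q = sets (X \<Otimes>\<^sub>M Y)"
  by (rule sets_pair_measure_cong) simp_all

lemma prob_Q: "prob_space Q"
  by (rule prob_space_pair[OF prob_P prob_PK])

lemma joint_kernel: "(\<lambda>x. K x \<bind> (\<lambda>y. return (X \<Otimes>\<^sub>M Y) (x, y))) \<in> X \<rightarrow>\<^sub>M prob_algebra (X \<Otimes>\<^sub>M Y)"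
  by (rule measurable_bind_prob_space2[OF K]) measurable

lemma sets_J [simp, measurable_cong]: "sets J = sets (X \<Otimes>\<^sub>M Y)"
  and prob_J: "prob_space J"
  unfolding joint_law_def using sets_bind'[OF P joint_kernel] prob_space_bind'[OF P joint_kernel] .

lemma space_J [simp]: "space J = space (X \<Otimes>\<^sub>M Y)"
  by (rule sets_eq_imp_space_eq) simp

lemma nn_integral_J:
  assumes [measurable]: "f \<in> borel_measurable (X \<Otimes>\<^sub>M Y)"
  shows "(\<integral>\<^sup>+z. f z \<partial>J) = (\<integral>\<^sup>+x. \<integral>\<^sup>+y. f (x, y) \<partial>K x \<partial>P)"
proof -
  have "(\<integral>\<^sup>+z. f z \<partial>J) = (\<integral>\<^sup>+x. \<integral>\<^sup>+z. f z \<partial>(K x \<bind> (\<lambda>y. return (X \<Otimes>\<^sub>M Y) (x, y))) \<partial>P)"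
    unfolding joint_law_def
    by (rule nn_integral_bind) (use measurable_prob_algebraD[OF joint_kernel] in measurable)
  also have "\<dots> = (\<integral>\<^sup>+x. \<integral>\<^sup>+y. f (x, y) \<partial>K x \<partial>P)"
  proof (rule nn_integral_cong)
    fix x assume "x \<in> space P"
    then have x [simp]: "x \<in> space X" by simp
    have "(\<integral>\<^sup>+z. f z \<partial>(K x \<bind> (\<lambda>y. return (X \<Otimes>\<^sub>M Y) (x, y))))
       = (\<integral>\<^sup>+y. \<integral>\<^sup>+z. f z \<partial>return (X \<Otimes>\<^sub>M Y) (x, y) \<partial>K x)"
      by (rule nn_integral_bind[of _ "X \<Otimes>\<^sub>M Y"])
        (simp_all add: measurable_cong_sets[OF sets_K[OF x] refl])
    also have "\<dots> = (\<integral>\<^sup>+y. f (x, y) \<partial>K x)"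
      by (rule nn_integral_cong, subst nn_integral_return) (auto simp: space_pair_measure)
    finally show "(\<integral>\<^sup>+z. f z \<partial>(K x \<bind> (\<lambda>y. return (X \<Otimes>\<^sub>M Y) (x, y)))) = (\<integral>\<^sup>+y. f (x, y) \<partial>K x)" .
  qed
  finally show ?thesis .
qed

lemma nn_integral_Q:
  assumes [measurable]: "f \<in> borel_measurable (X \<Otimes>\<^sub>M Y)"
  shows "(\<integral>\<^sup>+z. f z \<partial>Q) = (\<integral>\<^sup>+x. \<integral>\<^sup>+y. f (x, y) \<partial>(P \<bind> K) \<partial>P)"
proof -
  interpret PK: prob_space "P \<bind> K" by (rule prob_PK)
  show ?thesis by (rule PK.nn_integral_fst[symmetric]) measurable
qed

lemma sets_low [measurable]: "low t \<in> sets (X \<Otimes>\<^sub>M Y)"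
  and J_le_Q_on_low: "f \<in> borel_measurable (X \<Otimes>\<^sub>M Y) \<Longrightarrow>
    (\<integral>\<^sup>+z. f z * indicator (low t) z \<partial>J) \<le> exp t * (\<integral>\<^sup>+z. f z * indicator (low t) z \<partial>Q)"
  and Q_le_J_off_low: "f \<in> borel_measurable (X \<Otimes>\<^sub>M Y) \<Longrightarrow>
    exp t * (\<integral>\<^sup>+z. f z * indicator (space (X \<Otimes>\<^sub>M Y) - low t) z \<partial>Q)
      \<le> (\<integral>\<^sup>+z. f z * indicator (space (X \<Otimes>\<^sub>M Y) - low t) z \<partial>J)"
  using log_lr_dichotomy[of J Q _ t, OF prob_space.finite_measure[OF prob_J] prob_space.finite_measure[OF prob_Q]]
  by (simp_all add: low_def info_density_def cong: measurable_cong_sets)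

lemma emeasure_J:
  assumes [measurable]: "E \<in> sets (X \<Otimes>\<^sub>M Y)"
  shows "emeasure J E = (\<integral>\<^sup>+x. emeasure (K x) (Pair x -` E) \<partial>P)"
proof -
  have "emeasure J E = (\<integral>\<^sup>+z. indicator E z \<partial>J)" by simp
  also have "\<dots> = (\<integral>\<^sup>+x. \<integral>\<^sup>+y. indicator E (x, y) \<partial>K x \<partial>P)"
    by (rule nn_integral_J) measurable
  also have "\<dots> = (\<integral>\<^sup>+x. emeasure (K x) (Pair x -` E) \<partial>P)"
    by (intro nn_integral_cong)
      (simp add: sets_Pair1[OF assms] indicator_vimage[symmetric] comp_def flip: nn_integral_indicator)
  finally show ?thesis .
qed

lemma emeasure_Q:
  assumes [measurable]: "E \<in> sets (X \<Otimes>\<^sub>M Y)"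
  shows "emeasure Q E = (\<integral>\<^sup>+x. emeasure (P \<bind> K) (Pair x -` E) \<partial>P)"
proof -
  interpret PK: prob_space "P \<bind> K" by (rule prob_PK)
  show ?thesis by (rule PK.emeasure_pair_measure_alt) simp
qed

lemma emeasure_PK: "E \<in> sets Y \<Longrightarrow> emeasure (P \<bind> K) E = (\<integral>\<^sup>+x. emeasure (K x) E \<partial>P)"
  by (rule emeasure_bind[OF prob_space.not_empty[OF prob_P]]) simp_all

lemma measurable_emeasure_section [measurable]:
  assumes [measurable]: "E \<in> sets (X \<Otimes>\<^sub>M Y)" "N \<in> X \<rightarrow>\<^sub>M subprob_algebra Y"
  shows "(\<lambda>x. emeasure (N x) (Pair x -` E)) \<in> borel_measurable X"
proof -
  have "(\<integral>\<^sup>+y. indicator E (x, y) \<partial>N x) = emeasure (N x) (Pair x -` E)" if "x \<in> space X" for x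
    using subprob_measurableD(2)[OF assms(2) that] sets_Pair1[OF assms(1), of x]
    by (simp add: indicator_vimage[symmetric] comp_def flip: nn_integral_indicator)
  moreover have "(\<lambda>x. \<integral>\<^sup>+y. indicator E (x, y) \<partial>N x) \<in> borel_measurable X"
    by (rule nn_integral_measurable_subprob_algebra2[where N=Y]) measurable
  ultimately show ?thesis by (simp cong: measurable_cong)
qed

lemma J_low_Int_le_Q: "E \<in> sets (X \<Otimes>\<^sub>M Y) \<Longrightarrow> emeasure J (low t \<inter> E) \<le> exp t * emeasure Q (low t \<inter> E)"
  using J_le_Q_on_low[of "indicator E" t]
  by (simp add: indicator_inter_arith[symmetric] Int_commute)

lemma Q_diff_low_le_J: "E \<in> sets (X \<Otimes>\<^sub>M Y) \<Longrightarrow> exp t * emeasure Q (E - low t) \<le> emeasure J (E - low t)"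
proof -
  assume E [measurable]: "E \<in> sets (X \<Otimes>\<^sub>M Y)"
  have "indicator E z * indicator (space (X \<Otimes>\<^sub>M Y) - low t) z = (indicator (E - low t) z :: ennreal)" for z
    using sets.sets_into_space[OF E] by (auto simp: indicator_def)
  then show ?thesis using Q_le_J_off_low[of "indicator E" t] by simp
qed

section \<open>Bounds on sections at almost every input\<close>

text \<open>Over any input set \<open>G\<close>, the part of \<open>G \<times> space Y\<close> off
  \<open>low t\<close> has \<open>Q\<close>-measure at most \<open>exp (- t)\<close> times its
  \<open>J\<close>-measure, and the latter is at most the mass of \<open>G\<close>. Localising in
  \<open>G\<close> gives the bound for a single input: its high section is a decision region of
  small output probability.\<close>

lemma AE_output_of_high_section_le:
  "AE x in P. emeasure (P \<bind> K) (Pair x -` (space (X \<Otimes>\<^sub>M Y) - low t)) \<le> exp (- t)"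
proof (rule AE_le_const_of_set_integral_le[OF prob_space.finite_measure[OF prob_P]])
  interpret PK: prob_space "P \<bind> K" by (rule prob_PK)
  let ?T = "space (X \<Otimes>\<^sub>M Y) - low t"
  have PK: "P \<bind> K \<in> space (subprob_algebra Y)"
    using PK.prob_space_axioms by (auto simp: space_subprob_algebra prob_space_imp_subprob_space)
  show "(\<lambda>x. emeasure (P \<bind> K) (Pair x -` ?T)) \<in> borel_measurable P"
    using measurable_emeasure_section[of ?T "\<lambda>_. P \<bind> K"] PK by simp
  fix G assume "G \<in> sets P"
  then have G [measurable]: "G \<in> sets X" by simp
  let ?E = "(G \<times> space Y) - low t"
  have sec: "Pair x -` ?E = (if x \<in> G then Pair x -` ?T else {})" for x
    using sets.sets_into_space[OF G] by (auto simp: space_pair_measure)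
  have "exp t * (\<integral>\<^sup>+x. emeasure (P \<bind> K) (Pair x -` ?T) * indicator G x \<partial>P) = exp t * emeasure Q ?E"
    by (subst emeasure_Q) (auto simp: sec intro!: nn_integral_cong arg_cong2[where f="(*)"])
  also have "\<dots> \<le> emeasure J ?E"
    by (rule Q_diff_low_le_J) measurable
  also have "\<dots> \<le> emeasure J (G \<times> space Y)"
    by (rule emeasure_mono) auto
  also have "\<dots> = (\<integral>\<^sup>+x. indicator G x \<partial>P)"
  proof (subst emeasure_J)
    show "(\<integral>\<^sup>+x. emeasure (K x) (Pair x -` (G \<times> space Y)) \<partial>P) = (\<integral>\<^sup>+x. indicator G x \<partial>P)"
    proof (rule nn_integral_cong)
      fix x assume "x \<in> space P"
      then have x: "x \<in> space X" by simp
      have "emeasure (K x) (space Y) = 1"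
        using prob_space.emeasure_space_1[OF prob_K[OF x]] x by simp
      then show "emeasure (K x) (Pair x -` (G \<times> space Y)) = indicator G x"
        by (cases "x \<in> G") auto
    qed
  qed measurable
  also have "\<dots> = emeasure P G" by simp
  finally have "exp (- t) * (exp t * (\<integral>\<^sup>+x. emeasure (P \<bind> K) (Pair x -` ?T) * indicator G x \<partial>P))
    \<le> exp (- t) * emeasure P G"
    by (rule mult_left_mono) simp
  moreover have "ennreal (exp (- t)) * ennreal (exp t) = 1"
    by (simp add: exp_minus flip: ennreal_mult)
  ultimately show "(\<integral>\<^sup>+x. emeasure (P \<bind> K) (Pair x -` ?T) * indicator G x \<partial>P) \<le> exp (- t) * emeasure P G"
    by (simp flip: mult.assoc)
qed simp

text \<open>The same localisation for the other half of the dichotomy: on \<open>low t\<close> the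
  joint law is dominated by \<open>exp t * Q\<close>, and \<open>Q\<close> of a rectangle
  factorises. In the converse \<open>E\<close> is a decision region.\<close>

lemma AE_low_section_Int_le:
  assumes E [measurable]: "E \<in> sets Y"
  shows "AE x in P. emeasure (K x) (Pair x -` low t \<inter> E) \<le> exp t * emeasure (P \<bind> K) E"
proof (rule AE_le_const_of_set_integral_le[OF prob_space.finite_measure[OF prob_P]])
  interpret PK: prob_space "P \<bind> K" by (rule prob_PK)
  have sec0: "Pair x -` low t \<inter> E = Pair x -` (low t \<inter> (space X \<times> E))" if "x \<in> space X" for x
    using that by auto
  show "(\<lambda>x. emeasure (K x) (Pair x -` low t \<inter> E)) \<in> borel_measurable P"
  proof (rule measurable_cong[THEN iffD1])
    show "(\<lambda>x. emeasure (K x) (Pair x -` (low t \<inter> (space X \<times> E)))) \<in> borel_measurable P"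
      unfolding measurable_cong_sets[OF sets_P refl]
      by (rule measurable_emeasure_section) measurable
    show "emeasure (K x) (Pair x -` (low t \<inter> (space X \<times> E))) = emeasure (K x) (Pair x -` low t \<inter> E)"
      if "x \<in> space P" for x
      using that by (simp only: space_P sec0)
  qed
  show "exp t * emeasure (P \<bind> K) E < \<infinity>"
    by (simp add: ennreal_mult_less_top PK.emeasure_eq_measure)
  fix G assume "G \<in> sets P"
  then have G [measurable]: "G \<in> sets X" by simp
  let ?E = "low t \<inter> (G \<times> E)"
  have sec: "Pair x -` ?E = (if x \<in> G then Pair x -` low t \<inter> E else {})" for x
    by auto
  have "(\<integral>\<^sup>+x. emeasure (K x) (Pair x -` low t \<inter> E) * indicator G x \<partial>P) = emeasure J ?E"
    by (subst emeasure_J) (auto simp: sec intro!: nn_integral_cong)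
  also have "\<dots> \<le> exp t * emeasure Q ?E"
    by (rule J_low_Int_le_Q) measurable
  also have "\<dots> \<le> exp t * emeasure Q (G \<times> E)"
    by (intro mult_left_mono emeasure_mono) auto
  also have "\<dots> = exp t * (emeasure P G * emeasure (P \<bind> K) E)"
    by (subst PK.emeasure_pair_measure_Times) auto
  finally show "(\<integral>\<^sup>+x. emeasure (K x) (Pair x -` low t \<inter> E) * indicator G x \<partial>P)
    \<le> exp t * emeasure (P \<bind> K) E * emeasure P G"
    by (simp add: ac_simps)
qed

section \<open>Feinstein's construction of codes\<close>

text \<open>
  The bound on the output probability of the decision regions is only needed to make the
  induction on the number of codewords go through.
\<close>
theorem feinstein:
  fixes t :: real and k M :: nat
  assumes "k \<le> M"
  defines "\<epsilon> \<equiv> measure J (low t) + real M * exp (- t)"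
  shows "\<exists>c D. (\<forall>m<k. c m \<in> space X \<and> D m \<in> sets Y \<and>
      measure (P \<bind> K) (D m) \<le> exp (- t) \<and> measure (K (c m)) (space Y - D m) \<le> \<epsilon>) \<and>
    disjoint_family_on D {..<k}"
  using assms(1)
proof (induction k)
  case 0
  then show ?case by (auto simp: disjoint_family_on_def)
next
  case (Suc k)
  interpret P: prob_space P by (rule prob_P)
  interpret PK: prob_space "P \<bind> K" by (rule prob_PK)
  interpret J: prob_space J by (rule prob_J)
  have \<epsilon>0: "0 \<le> \<epsilon>" by (simp add: \<epsilon>_def)
  from Suc obtain c D where
    cD: "\<And>m. m < k \<Longrightarrow> c m \<in> space X" "\<And>m. m < k \<Longrightarrow> D m \<in> sets Y"
      "\<And>m. m < k \<Longrightarrow> measure (P \<bind> K) (D m) \<le> exp (- t)"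
      "\<And>m. m < k \<Longrightarrow> measure (K (c m)) (space Y - D m) \<le> \<epsilon>"
    and disj: "disjoint_family_on D {..<k}"
    by (auto simp: Suc_le_eq)
  \<comment> \<open>The outputs already claimed by earlier codewords; the next decision region must
    avoid them.\<close>
  define U where "U = (\<Union>m<k. D m)"
  have U [measurable]: "U \<in> sets Y" using cD(2) by (auto simp: U_def)
  have "measure (P \<bind> K) U \<le> (\<Sum>m<k. measure (P \<bind> K) (D m))"
    unfolding U_def using cD(2) by (intro PK.finite_measure_subadditive_finite) auto
  also have "\<dots> \<le> (\<Sum>m<k. exp (- t))" by (intro sum_mono cD(3)) auto
  finally have PU: "measure (P \<bind> K) U \<le> real k * exp (- t)" by simp
  \<comment> \<open>The section of \<open>F\<close> at \<open>x\<close> contains every output on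
    which a new codeword \<open>x\<close> would be decoded wrongly: low density, or already
    claimed.\<close>
  define F where "F = low t \<union> space X \<times> U"
  have F [measurable]: "F \<in> sets (X \<Otimes>\<^sub>M Y)" unfolding F_def by measurable
  have secF: "Pair x -` F = Pair x -` low t \<union> U" if "x \<in> space X" for x
    using that by (auto simp: F_def)
  have "(\<integral>\<^sup>+x. emeasure (K x) (Pair x -` F) \<partial>P) = emeasure J F"
    by (rule emeasure_J[symmetric]) fact
  also have "\<dots> \<le> emeasure J (low t) + emeasure J (space X \<times> U)"
    unfolding F_def by (rule emeasure_subadditive) auto
  also have "emeasure J (space X \<times> U) = emeasure (P \<bind> K) U"
    by (auto simp: emeasure_J emeasure_PK intro!: nn_integral_cong)
  also have "emeasure J (low t) + emeasure (P \<bind> K) U = ennreal (measure J (low t) + measure (P \<bind> K) U)"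
    by (simp add: J.emeasure_eq_measure PK.emeasure_eq_measure)
  also have "\<dots> < ennreal \<epsilon>"
  proof (rule ennreal_lessI)
    \<comment> \<open>As only \<open>k < M\<close> codewords have been placed, the bound is strict;
      this drives the contradiction below.\<close>
    have "real k * exp (- t) < real M * exp (- t)" using Suc.prems by simp
    then show less: "measure J (low t) + measure (P \<bind> K) U < \<epsilon>"
      using PU unfolding \<epsilon>_def by linarith
    show "0 < \<epsilon>"
      by (rule le_less_trans[OF _ less]) simp
  qed
  finally have small: "(\<integral>\<^sup>+x. emeasure (K x) (Pair x -` F) \<partial>P) < ennreal \<epsilon>" .
  have "\<exists>x\<in>space X. emeasure (P \<bind> K) (Pair x -` (space (X \<Otimes>\<^sub>M Y) - low t)) \<le> exp (- t) \<and>
      emeasure (K x) (Pair x -` F) \<le> \<epsilon>"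
  proof (rule ccontr)
    \<comment> \<open>Almost every input satisfies the first bound. If each of these violated the
      second, the average error over \<open>P\<close> would be at least \<open>\<epsilon>\<close>,
      against \<open>small\<close>.\<close>
    assume neg: "\<not> ?thesis"
    have "AE x in P. ennreal \<epsilon> \<le> emeasure (K x) (Pair x -` F)"
      using AE_output_of_high_section_le[of t] AE_space
      by eventually_elim (use neg in \<open>auto simp: not_le intro: less_imp_le\<close>)
    then have "(\<integral>\<^sup>+x. ennreal \<epsilon> \<partial>P) \<le> (\<integral>\<^sup>+x. emeasure (K x) (Pair x -` F) \<partial>P)"
      by (rule nn_integral_mono_AE)
    with small show False by (simp add: P.emeasure_space_1[unfolded space_P])
  qed
  then obtain x where x: "x \<in> space X"
    and xQ: "emeasure (P \<bind> K) (Pair x -` (space (X \<Otimes>\<^sub>M Y) - low t)) \<le> exp (- t)"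
    and xK: "emeasure (K x) (Pair x -` F) \<le> \<epsilon>" by blast
  interpret Kx: prob_space "K x" by (rule prob_K) fact
  define E where "E = Pair x -` (space (X \<Otimes>\<^sub>M Y) - low t) - U"
  have sec [measurable]: "Pair x -` (space (X \<Otimes>\<^sub>M Y) - low t) \<in> sets Y"
    by (rule sets_Pair1) measurable
  have E [measurable]: "E \<in> sets Y" unfolding E_def by measurable
  have "emeasure (P \<bind> K) E \<le> exp (- t)"
    by (rule order_trans[OF emeasure_mono xQ]) (auto simp: E_def)
  then have E1: "measure (P \<bind> K) E \<le> exp (- t)"
    by (simp add: PK.emeasure_eq_measure)
  have "emeasure (K x) (space Y - E) \<le> emeasure (K x) (Pair x -` F)"
    by (rule emeasure_mono) (use x in \<open>auto simp: E_def secF space_pair_measure sets_Pair1\<close>)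
  with xK have "emeasure (K x) (space Y - E) \<le> \<epsilon>" by simp
  then have E2: "measure (K x) (space Y - E) \<le> \<epsilon>"
    using \<epsilon>0 by (simp add: Kx.emeasure_eq_measure)
  have disjE: "E \<inter> D m = {}" if "m < k" for m
    using that by (auto simp: E_def U_def)
  show ?case
  proof (intro exI conjI)
    show "\<forall>m<Suc k. (c(k := x)) m \<in> space X \<and> (D(k := E)) m \<in> sets Y \<and>
      measure (P \<bind> K) ((D(k := E)) m) \<le> exp (- t) \<and> measure (K ((c(k := x)) m)) (space Y - (D(k := E)) m) \<le> \<epsilon>"
      using cD x E E1 E2 by (auto simp: less_Suc_eq)
    show "disjoint_family_on (D(k := E)) {..<Suc k}"
      unfolding disjoint_family_on_def
    proof (intro ballI impI)
      fix a b assume "a \<in> {..<Suc k}" "b \<in> {..<Suc k}" "a \<noteq> b"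
      then show "(D(k := E)) a \<inter> (D(k := E)) b = {}"
        using disjoint_family_onD[OF disj, of a b] disjE[of a] disjE[of b]
        by (cases "a = k"; cases "b = k") auto
    qed
  qed
qed

end

section \<open>Data processing through a degrading channel\<close>

text \<open>An event for the degraded output becomes a randomised test on the original pair: accept
  \<open>(x, y)\<close> with the probability that \<open>q y\<close> gives to the section at
  \<open>x\<close>. One and the same test represents the event under the joint law and under the
  product of marginals.\<close>

lemma (in channel_input) emeasure_joint_bind:
  assumes q: "q \<in> Y \<rightarrow>\<^sub>M prob_algebra Z" and [measurable]: "E \<in> sets (X \<Otimes>\<^sub>M Z)"
  shows "emeasure (joint_law X Z (\<lambda>x. K x \<bind> q) P) E = (\<integral>\<^sup>+(x, y). emeasure (q y) (Pair x -` E) \<partial>J)"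
    and "emeasure (P \<Otimes>\<^sub>M (P \<bind> (\<lambda>x. K x \<bind> q))) E = (\<integral>\<^sup>+(x, y). emeasure (q y) (Pair x -` E) \<partial>Q)"
    and "(\<lambda>(x, y). emeasure (q y) (Pair x -` E)) \<in> borel_measurable (X \<Otimes>\<^sub>M Y)"
proof -
  have [measurable]: "q \<in> Y \<rightarrow>\<^sub>M subprob_algebra Z" using q by (rule measurable_prob_algebraD)
  interpret Kq: channel_input X Z "\<lambda>x. K x \<bind> q" P
    by standard (rule P, rule measurable_bind_prob_space[OF K q])
  have *: "(\<lambda>z. \<integral>\<^sup>+w. indicator E (fst z, w) \<partial>q (snd z)) \<in> borel_measurable (X \<Otimes>\<^sub>M Y)"
    by (rule nn_integral_measurable_subprob_algebra2[where N=Z]) measurable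
  have "(\<integral>\<^sup>+w. indicator E (x, w) \<partial>q y) = emeasure (q y) (Pair x -` E)" if "y \<in> space Y" for x y
    using subprob_measurableD(2)[OF _ that, of q Z] sets_Pair1[OF assms(2), of x]
    by (simp add: indicator_vimage[symmetric] comp_def flip: nn_integral_indicator)
  then show m [measurable]: "(\<lambda>(x, y). emeasure (q y) (Pair x -` E)) \<in> borel_measurable (X \<Otimes>\<^sub>M Y)"
    by (intro measurable_cong[THEN iffD1, OF _ *]) (auto simp: space_pair_measure)
  show "emeasure (joint_law X Z (\<lambda>x. K x \<bind> q) P) E = (\<integral>\<^sup>+(x, y). emeasure (q y) (Pair x -` E) \<partial>J)"
    unfolding Kq.emeasure_J[OF assms(2)] nn_integral_J[OF m]
  proof (rule nn_integral_cong)
    fix x assume "x \<in> space P"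
    then have x: "x \<in> space X" by simp
    show "emeasure (K x \<bind> q) (Pair x -` E) = (\<integral>\<^sup>+y. (case (x, y) of (x, y) \<Rightarrow> emeasure (q y) (Pair x -` E)) \<partial>K x)"
      unfolding prod.case
      by (rule emeasure_bind[where N=Z])
         (use x in \<open>auto simp: prob_space.not_empty prob_K sets_Pair1 measurable_cong_sets[OF sets_K refl] simp flip: space_K\<close>)
  qed
  \<comment> \<open>Degrading commutes with averaging over the input, so the output law of the
    composite channel is the degraded output law.\<close>
  have PK: "P \<bind> (\<lambda>x. K x \<bind> q) = (P \<bind> K) \<bind> q"
    by (rule bind_assoc[symmetric]) measurable
  show "emeasure (P \<Otimes>\<^sub>M (P \<bind> (\<lambda>x. K x \<bind> q))) E = (\<integral>\<^sup>+(x, y). emeasure (q y) (Pair x -` E) \<partial>Q)"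
    unfolding Kq.emeasure_Q[OF assms(2)] nn_integral_Q[OF m]
  proof (rule nn_integral_cong)
    fix x
    show "emeasure (P \<bind> (\<lambda>x. K x \<bind> q)) (Pair x -` E) = (\<integral>\<^sup>+y. (case (x, y) of (x, y) \<Rightarrow> emeasure (q y) (Pair x -` E)) \<partial>(P \<bind> K))"
      unfolding prod.case PK
      by (rule emeasure_bind[where N=Z])
         (auto simp: prob_space.not_empty prob_PK sets_Pair1 simp flip: space_PK)
  qed
qed

text \<open>Let the test \<open>\<phi>\<close> be the high event of the degraded pair. Its failure
  probability under \<open>J\<close> is the probability of the degraded low event. Where it succeeds
  inside \<open>low t'\<close>, \<open>J\<close> is at most \<open>exp t'\<close> times
  \<open>Q\<close>, and under \<open>Q\<close> the test succeeds with probability at most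
  \<open>exp (- t)\<close>.\<close>

lemma (in channel_input) measure_low_bind_le:
  assumes q: "q \<in> Y \<rightarrow>\<^sub>M prob_algebra Z"
  shows "measure J (low t') \<le> measure (joint_law X Z (\<lambda>x. K x \<bind> q) P)
    (channel_input.low X Z (\<lambda>x. K x \<bind> q) P t) + exp (t' - t)"
proof -
  interpret J: prob_space J by (rule prob_J)
  interpret w: channel_input X Z "\<lambda>x. K x \<bind> q" P
    by standard (rule P, rule measurable_bind_prob_space[OF K q])
  interpret wJ: prob_space w.J by (rule w.prob_J)
  interpret wQ: prob_space w.Q by (rule w.prob_Q)
  let ?T = "space (X \<Otimes>\<^sub>M Z) - w.low t"
  define \<phi> where "\<phi> = (\<lambda>(x, y). emeasure (q y) (Pair x -` ?T))"
  have \<phi>m [measurable]: "\<phi> \<in> borel_measurable (X \<Otimes>\<^sub>M Y)"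
    and \<phi>J: "emeasure w.J ?T = (\<integral>\<^sup>+z. \<phi> z \<partial>J)" and \<phi>Q: "emeasure w.Q ?T = (\<integral>\<^sup>+z. \<phi> z \<partial>Q)"
    unfolding \<phi>_def using emeasure_joint_bind[OF q, of ?T] by simp_all
  have \<phi>1: "\<phi> z \<le> 1" if "z \<in> space J" for z
    using that measurable_space[OF q]
    by (auto simp: \<phi>_def space_pair_measure space_prob_algebra intro!: subprob_space.subprob_emeasure_le_1 prob_space_imp_subprob_space)
  have "exp t * emeasure w.Q ?T \<le> emeasure w.J ?T"
    using w.Q_diff_low_le_J[of "space (X \<Otimes>\<^sub>M Z)" t] by simp
  then have "ennreal (exp t * measure w.Q ?T) \<le> ennreal (measure w.J ?T)"
    by (simp add: wQ.emeasure_eq_measure wJ.emeasure_eq_measure ennreal_mult)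
  then have "exp t * measure w.Q ?T \<le> 1"
    using wJ.prob_le_1[of ?T] by (simp add: order_trans)
  then have Q: "measure w.Q ?T \<le> exp (- t)"
    by (simp add: exp_minus field_simps)
  have "emeasure J (low t') = (\<integral>\<^sup>+z. indicator (low t') z \<partial>J)" by simp
  \<comment> \<open>The indicator is split by success and failure of the test, and the restriction
    to \<open>low t'\<close> is dropped from the failure part.\<close>
  also have "\<dots> \<le> (\<integral>\<^sup>+z. \<phi> z * indicator (low t') z + (1 - \<phi> z) \<partial>J)"
  proof (rule nn_integral_mono)
    fix z assume "z \<in> space J"
    then show "indicator (low t') z \<le> \<phi> z * indicator (low t') z + (1 - \<phi> z)"
      using \<phi>1[of z] by (cases "z \<in> low t'") (auto simp: add.commute[of "\<phi> z"] diff_add_cancel_ennreal)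
  qed
  also have "\<dots> = (\<integral>\<^sup>+z. \<phi> z * indicator (low t') z \<partial>J) + (\<integral>\<^sup>+z. (1 - \<phi> z) \<partial>J)"
    by (rule nn_integral_add) measurable
  also have "(\<integral>\<^sup>+z. (1 - \<phi> z) \<partial>J) = 1 - emeasure w.J ?T"
    unfolding \<phi>J using \<phi>1
    by (subst nn_integral_diff) (auto simp: J.emeasure_space_1[unfolded space_J] simp flip: \<phi>J)
  also have "1 - emeasure w.J ?T = emeasure w.J (w.low t)"
    using wJ.prob_compl[of "w.low t"]
    by (simp add: wJ.emeasure_eq_measure ennreal_1[symmetric] ennreal_minus del: ennreal_1)
  also have "(\<integral>\<^sup>+z. \<phi> z * indicator (low t') z \<partial>J) \<le> exp t' * (\<integral>\<^sup>+z. \<phi> z * indicator (low t') z \<partial>Q)"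
    by (rule J_le_Q_on_low) measurable
  also have "\<dots> \<le> exp t' * (\<integral>\<^sup>+z. \<phi> z \<partial>Q)"
    by (intro mult_left_mono nn_integral_mono) (auto simp: indicator_def)
  also have "\<dots> = ennreal (exp t' * measure w.Q ?T)"
    by (simp add: \<phi>Q[symmetric] wQ.emeasure_eq_measure ennreal_mult)
  also have "\<dots> \<le> ennreal (exp t' * exp (- t))"
    using Q by (intro ennreal_leI mult_left_mono) auto
  finally have "emeasure J (low t') \<le> ennreal (exp t' * exp (- t)) + emeasure w.J (w.low t)"
    by (simp add: add_right_mono)
  then show ?thesis
    by (simp add: J.emeasure_eq_measure wJ.emeasure_eq_measure exp_diff exp_minus field_simps flip: ennreal_plus)
qed

section \<open>The converse\<close>

text \<open>Pushing forward the uniform message keeps repeated codewords with their multiplicity, so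
  integrals are averages over messages.\<close>

definition uniform_input :: "'a measure \<Rightarrow> nat \<Rightarrow> (nat \<Rightarrow> 'a) \<Rightarrow> 'a measure" where
  "uniform_input X M c = distr (uniform_count_measure {..<M}) X c"

lemma uniform_input_in_prob_algebra:
  assumes "M \<ge> 1" "\<And>m. m < M \<Longrightarrow> c m \<in> space X"
  shows "uniform_input X M c \<in> space (prob_algebra X)"
proof -
  interpret prob_space "uniform_count_measure {..<M}"
    by (rule prob_space_uniform_count_measure) (use assms in \<open>auto simp: lessThan_empty_iff\<close>)
  have "c \<in> uniform_count_measure {..<M} \<rightarrow>\<^sub>M X"
    using assms by (auto simp: measurable_def space_uniform_count_measure sets_uniform_count_measure)
  then show ?thesis
    by (simp add: uniform_input_def space_prob_algebra prob_space_distr)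
qed

lemma nn_integral_uniform_input:
  assumes "M \<ge> 1" "\<And>m. m < M \<Longrightarrow> c m \<in> space X" and f: "f \<in> borel_measurable X"
  shows "(\<integral>\<^sup>+x. f x \<partial>uniform_input X M c) = (\<Sum>m<M. ennreal (1 / real M) * f (c m))"
proof -
  have "c \<in> uniform_count_measure {..<M} \<rightarrow>\<^sub>M X"
    using assms by (auto simp: measurable_def space_uniform_count_measure sets_uniform_count_measure)
  then show ?thesis using f
    by (simp add: uniform_input_def nn_integral_distr uniform_count_measure_def nn_integral_point_measure_finite)
qed

text \<open>
  Singletons of the input space need not be measurable and codewords may coincide, so properties
  of individual codewords are obtained from almost sure statements.
\<close>
lemma AE_uniform_inputD:
  assumes "M \<ge> 1" "\<And>m. m < M \<Longrightarrow> c m \<in> space X" and "AE x in uniform_input X M c. R x" "m < M"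
  shows "R (c m)"
proof -
  have "c \<in> uniform_count_measure {..<M} \<rightarrow>\<^sub>M X"
    using assms by (auto simp: measurable_def space_uniform_count_measure sets_uniform_count_measure)
  from AE_distrD[OF this assms(3)[unfolded uniform_input_def]]
  \<comment> \<open>Every message has positive mass, so almost every message means every
    message.\<close>
  have "\<forall>m\<in>{..<M}. 0 < ennreal (1 / real (card {..<M})) \<longrightarrow> R (c m)"
    unfolding uniform_count_measure_def AE_point_measure .
  then show ?thesis using assms(1,4) by simp
qed

text \<open>For each codeword the low section splits into a part outside its decision region, which
  is a decoding error, and a part inside, which is at most \<open>exp t\<close> times the output
  probability of that region. The regions are disjoint, so these probabilities sum to at most 1, and
  averaging over the messages leaves \<open>exp t / M\<close>.\<close>

theorem verdu_han:
  assumes M: "M \<ge> 1" and c: "\<And>m. m < M \<Longrightarrow> c m \<in> space X" and K: "K \<in> X \<rightarrow>\<^sub>M prob_algebra Y"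
    and D: "\<And>m. m < M \<Longrightarrow> D m \<in> sets Y" and disj: "disjoint_family_on D {..<M}"
  shows "measure (joint_law X Y K (uniform_input X M c)) (channel_input.low X Y K (uniform_input X M c) t)
    \<le> (\<Sum>m<M. measure (K (c m)) (space Y - D m)) / real M + exp t / real M"
proof -
  interpret channel_input X Y K "uniform_input X M c"
    by standard (rule uniform_input_in_prob_algebra[OF M c], assumption, rule K)
  interpret J: prob_space J by (rule prob_J)
  let ?PK = "uniform_input X M c \<bind> K"
  interpret PK: prob_space ?PK by (rule prob_PK)
  have sec: "measure (K (c m)) (Pair (c m) -` low t) \<le> measure (K (c m)) (space Y - D m) + exp t * measure ?PK (D m)"
    if m: "m < M" for m
  proof -
    interpret Km: prob_space "K (c m)" by (rule prob_K[OF c[OF m]])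
    note [measurable] = D[OF m] sets_Pair1[OF sets_low, of "c m" t]
    have sK [measurable_cong]: "sets (K (c m)) = sets Y" by (rule sets_K[OF c[OF m]])
    have "emeasure (K (c m)) (Pair (c m) -` low t \<inter> D m) \<le> exp t * emeasure ?PK (D m)"
      by (rule AE_uniform_inputD[OF M c AE_low_section_Int_le[OF D[OF m]] m])
    then have *: "measure (K (c m)) (Pair (c m) -` low t \<inter> D m) \<le> exp t * measure ?PK (D m)"
      by (simp add: Km.emeasure_eq_measure PK.emeasure_eq_measure flip: ennreal_mult)
    have "measure (K (c m)) (Pair (c m) -` low t) \<le> measure (K (c m)) ((space Y - D m) \<union> (Pair (c m) -` low t \<inter> D m))"
    proof (rule Km.finite_measure_mono)
      show "Pair (c m) -` low t \<subseteq> space Y - D m \<union> Pair (c m) -` low t \<inter> D m"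
        using sets.sets_into_space[OF sets_low] by (auto simp: space_pair_measure)
      have "space Y - D m \<union> Pair (c m) -` low t \<inter> D m \<in> sets Y" by measurable
      then show "space Y - D m \<union> Pair (c m) -` low t \<inter> D m \<in> sets (K (c m))" by (simp only: sK)
    qed
    also have "\<dots> \<le> measure (K (c m)) (space Y - D m) + measure (K (c m)) (Pair (c m) -` low t \<inter> D m)"
      by (rule measure_Un_le) (simp_all only: sK, measurable)
    finally show ?thesis using * by simp
  qed
  have "emeasure J (low t) = (\<Sum>m<M. ennreal (1 / real M) * emeasure (K (c m)) (Pair (c m) -` low t))"
    unfolding emeasure_J[OF sets_low]
    by (rule nn_integral_uniform_input[OF M c]) simp_all
  also have "\<dots> = (\<Sum>m<M. ennreal (measure (K (c m)) (Pair (c m) -` low t) / real M))"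
  proof (rule sum.cong)
    fix m assume "m \<in> {..<M}"
    then interpret Km: prob_space "K (c m)" using prob_K c by simp
    show "ennreal (1 / real M) * emeasure (K (c m)) (Pair (c m) -` low t)
      = ennreal (measure (K (c m)) (Pair (c m) -` low t) / real M)"
      by (simp add: Km.emeasure_eq_measure flip: ennreal_mult)
  qed simp
  finally have "measure J (low t) = (\<Sum>m<M. measure (K (c m)) (Pair (c m) -` low t)) / real M"
    by (simp add: J.emeasure_eq_measure sum_nonneg sum_divide_distrib)
  also have "\<dots> \<le> (\<Sum>m<M. measure (K (c m)) (space Y - D m) + exp t * measure ?PK (D m)) / real M"
    by (intro divide_right_mono sum_mono sec) auto
  also have "\<dots> = (\<Sum>m<M. measure (K (c m)) (space Y - D m)) / real M + exp t * measure ?PK (\<Union>m<M. D m) / real M"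
    using D disj by (subst PK.finite_measure_finite_Union)
      (auto simp: sum.distrib sum_distrib_left add_divide_distrib)
  also have "exp t * measure ?PK (\<Union>m<M. D m) / real M \<le> exp t / real M"
    by (intro divide_right_mono) (auto intro: mult_left_le)
  finally show ?thesis by simp
qed

section \<open>Maximum likelihood decoding\<close>

text \<open>\<open>f m y\<close> is the probability that a randomised decoder answers
  \<open>m\<close> on output \<open>y\<close>. Pointwise, its weighted likelihood
  \<open>\<Sum>m. p m y * f m y\<close> is at most the largest likelihood, which the deterministic
  maximum likelihood decision attains.\<close>

lemma ex_disjoint_decision_regions:
  fixes f :: "nat \<Rightarrow> 'a \<Rightarrow> ennreal"
  assumes \<mu>: "\<And>m. m < M \<Longrightarrow> \<mu> m \<in> space (prob_algebra Y)" and M: "M \<ge> 1"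
    and f [measurable]: "\<And>m. m < M \<Longrightarrow> f m \<in> borel_measurable Y"
    and f1: "\<And>y. y \<in> space Y \<Longrightarrow> (\<Sum>m<M. f m y) \<le> 1"
  shows "\<exists>D. (\<forall>m<M. D m \<in> sets Y) \<and> disjoint_family_on D {..<M} \<and>
    (\<Sum>m<M. \<integral>\<^sup>+y. f m y \<partial>\<mu> m) \<le> (\<Sum>m<M. emeasure (\<mu> m) (D m))"
proof -
  have \<mu>s: "sets (\<mu> m) = sets Y" and \<mu>p: "prob_space (\<mu> m)" if "m < M" for m
    using \<mu>[OF that] by (auto simp: space_prob_algebra)
  have \<mu>1: "emeasure (\<mu> m) (space Y) = 1" if "m < M" for m
    using prob_space.emeasure_space_1[OF \<mu>p[OF that]] sets_eq_imp_space_eq[OF \<mu>s[OF that]] by simp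
  \<comment> \<open>The sum of the \<open>M\<close> laws, written as a bind over the counting
    measure. It dominates each \<open>\<mu> m\<close>, so all have densities with respect to
    it.\<close>
  define L where "L = count_space {..<M} \<bind> \<mu>"
  have \<mu>k: "\<mu> \<in> count_space {..<M} \<rightarrow>\<^sub>M subprob_algebra Y"
    using \<mu> by (auto simp: space_prob_algebra space_subprob_algebra prob_space_imp_subprob_space)
  have ne: "space (count_space {..<M}) \<noteq> {}" using M by (auto simp: lessThan_empty_iff)
  have sL [measurable_cong, simp]: "sets L = sets Y"
    unfolding L_def by (rule sets_bind[OF _ ne]) (simp add: \<mu>s)
  have spL [simp]: "space L = space Y" by (rule sets_eq_imp_space_eq) simp
  have eL: "emeasure L E = (\<Sum>m<M. emeasure (\<mu> m) E)" if "E \<in> sets Y" for E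
    unfolding L_def using emeasure_bind[OF ne \<mu>k that] by (simp add: nn_integral_count_space_finite)
  interpret L: finite_measure L
    by (rule finite_measureI)
       (simp add: eL \<mu>1)
  define p where "p = (\<lambda>m. RN_deriv L (\<mu> m))"
  have p [measurable]: "p m \<in> borel_measurable Y" for m
    using borel_measurable_RN_deriv[of L "\<mu> m"] by (simp add: p_def cong: measurable_cong_sets)
  have d: "density L (p m) = \<mu> m" if "m < M" for m
    unfolding p_def
  proof (rule L.density_RN_deriv)
    show "absolutely_continuous L (\<mu> m)"
      unfolding absolutely_continuous_def
    proof
      fix E assume "E \<in> null_sets L"
      then show "E \<in> null_sets (\<mu> m)"
        using that by (auto simp: null_sets_def eL \<mu>s)
    qed
  qed (simp add: \<mu>s that)
  \<comment> \<open>Ties go to the smallest index: strictness against smaller indices makes the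
    regions disjoint.\<close>
  define D where "D = (\<lambda>m. {y \<in> space Y. (\<forall>k\<in>{..<M}. p k y \<le> p m y) \<and> (\<forall>k\<in>{..<m}. p k y < p m y)})"
  have D [measurable]: "D m \<in> sets Y" for m
    unfolding D_def by measurable
  have disj: "disjoint_family_on D {..<M}"
    unfolding disjoint_family_on_def
  proof (intro ballI impI)
    fix a b assume "a \<in> {..<M}" "b \<in> {..<M}" "a \<noteq> b"
    then show "D a \<inter> D b = {}"
      by (cases a b rule: linorder_cases) (auto simp: D_def not_less[symmetric])
  qed
  have pw: "(\<Sum>m<M. p m y * f m y) \<le> (\<Sum>m<M. p m y * indicator (D m) y)" if y: "y \<in> space Y" for y
  proof -
    define mx where "mx = Max ((\<lambda>m. p m y) ` {..<M})"
    have fin: "finite ((\<lambda>m. p m y) ` {..<M})" "(\<lambda>m. p m y) ` {..<M} \<noteq> {}"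
      using M by (auto simp: lessThan_empty_iff)
    have le: "p m y \<le> mx" if "m < M" for m
      unfolding mx_def using that fin by (intro Max_ge) auto
    have "\<exists>m. m < M \<and> p m y = mx"
      using Max_in[OF fin] unfolding mx_def by (metis (mono_tags, lifting) imageE lessThan_iff)
    \<comment> \<open>The least maximiser is the index whose region contains
      \<open>y\<close>.\<close>
    define m0 where "m0 = (LEAST m. m < M \<and> p m y = mx)"
    have m0: "m0 < M" "p m0 y = mx"
      using LeastI_ex[OF \<open>\<exists>m. m < M \<and> p m y = mx\<close>] by (auto simp: m0_def)
    have "p k y < mx" if "k < m0" for k
      using not_less_Least[of k "\<lambda>m. m < M \<and> p m y = mx", folded m0_def, OF that] that m0(1) le[of k]
      by (simp add: order_less_le)
    then have "y \<in> D m0" using m0 le y by (auto simp: D_def)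
    have "(\<Sum>m<M. p m y * f m y) \<le> (\<Sum>m<M. mx * f m y)"
      by (intro sum_mono mult_right_mono le) auto
    also have "\<dots> \<le> mx"
      using mult_left_mono[OF f1[OF y], of mx] by (simp add: sum_distrib_left)
    also have "\<dots> = p m0 y * indicator (D m0) y" using m0 \<open>y \<in> D m0\<close> by simp
    also have "\<dots> \<le> (\<Sum>m<M. p m y * indicator (D m) y)"
      using m0 by (intro member_le_sum) auto
    finally show ?thesis .
  qed
  have "(\<Sum>m<M. \<integral>\<^sup>+y. f m y \<partial>\<mu> m) = (\<Sum>m<M. \<integral>\<^sup>+y. p m y * f m y \<partial>L)"
    by (intro sum.cong) (auto simp: nn_integral_density simp flip: d)
  also have "\<dots> = (\<integral>\<^sup>+y. (\<Sum>m<M. p m y * f m y) \<partial>L)"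
    by (rule nn_integral_sum[symmetric]) auto
  also have "\<dots> \<le> (\<integral>\<^sup>+y. (\<Sum>m<M. p m y * indicator (D m) y) \<partial>L)"
    by (intro nn_integral_mono pw) simp
  also have "\<dots> = (\<Sum>m<M. \<integral>\<^sup>+y. p m y * indicator (D m) y \<partial>L)"
    by (rule nn_integral_sum) auto
  also have "\<dots> = (\<Sum>m<M. emeasure (\<mu> m) (D m))"
    by (intro sum.cong) (auto simp: emeasure_density simp flip: d)
  finally show ?thesis using disj by (intro exI[of _ D]) auto
qed

text \<open>Degrading the output through \<open>q\<close> and then using the regions
  \<open>D\<close> is a randomised decoder on \<open>Y\<close> that answers \<open>m\<close> with
  probability \<open>q y (D m)\<close>; disjointness of \<open>D\<close> makes these sum to at most
  1. Maximum likelihood regions succeed at least as often.\<close>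

lemma degraded_decoding:
  fixes M :: nat
  assumes q: "q \<in> Y \<rightarrow>\<^sub>M prob_algebra Z" and M: "M \<ge> 1"
    and \<mu>: "\<And>m. m < M \<Longrightarrow> \<mu> m \<in> space (prob_algebra Y)"
    and D: "\<And>m. m < M \<Longrightarrow> D m \<in> sets Z" and disj: "disjoint_family_on D {..<M}"
  shows "\<exists>D'. (\<forall>m<M. D' m \<in> sets Y) \<and> disjoint_family_on D' {..<M} \<and>
    (\<Sum>m<M. measure (\<mu> m) (space Y - D' m)) \<le> (\<Sum>m<M. measure (\<mu> m \<bind> q) (space Z - D m))"
proof -
  have qk [measurable]: "q \<in> Y \<rightarrow>\<^sub>M subprob_algebra Z" using q by (rule measurable_prob_algebraD)
  have qs: "sets (q y) = sets Z" "prob_space (q y)" if "y \<in> space Y" for y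
    using measurable_space[OF q that] by (auto simp: space_prob_algebra)
  have \<mu>s: "sets (\<mu> m) = sets Y" and \<mu>p: "prob_space (\<mu> m)" if "m < M" for m
    using \<mu>[OF that] by (auto simp: space_prob_algebra)
  have "(\<Sum>m<M. emeasure (q y) (D m)) \<le> 1" if "y \<in> space Y" for y
  proof -
    interpret prob_space "q y" by (rule qs) fact
    have "(\<Sum>m<M. emeasure (q y) (D m)) = emeasure (q y) (\<Union>m<M. D m)"
      using D disj qs[OF that] by (intro sum_emeasure) auto
    then show ?thesis by (simp add: emeasure_le_1)
  qed
  then obtain D' where D': "\<forall>m<M. D' m \<in> sets Y" "disjoint_family_on D' {..<M}"
    and le: "(\<Sum>m<M. \<integral>\<^sup>+y. emeasure (q y) (D m) \<partial>\<mu> m) \<le> (\<Sum>m<M. emeasure (\<mu> m) (D' m))"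
    using ex_disjoint_decision_regions[of M \<mu> Y "\<lambda>m y. emeasure (q y) (D m)", OF \<mu> M
        measurable_emeasure_kernel[OF qk D]]
    by blast
  \<comment> \<open>Success probabilities become one minus errors; the bounds \<open>3\<close> keep
    these differences nonnegative, so that the extended inequality can be read in the reals.\<close>
  have 1: "(\<integral>\<^sup>+y. emeasure (q y) (D m) \<partial>\<mu> m) = ennreal (1 - measure (\<mu> m \<bind> q) (space Z - D m))"
    and 2: "emeasure (\<mu> m) (D' m) = ennreal (1 - measure (\<mu> m) (space Y - D' m))"
    and 3: "measure (\<mu> m \<bind> q) (space Z - D m) \<le> 1" "measure (\<mu> m) (space Y - D' m) \<le> 1"
    if m: "m < M" for m
  proof -
    interpret prob_space "\<mu> m" by (rule \<mu>p) fact
    interpret q: prob_space "\<mu> m \<bind> q" by (rule prob_space_bind'[OF \<mu>[OF m] q])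
    have sq: "sets (\<mu> m \<bind> q) = sets Z" by (rule sets_bind'[OF \<mu>[OF m] q])
    have "(\<integral>\<^sup>+y. emeasure (q y) (D m) \<partial>\<mu> m) = emeasure (\<mu> m \<bind> q) (D m)"
      by (rule emeasure_bind[symmetric, OF not_empty _ D[OF m]])
        (simp add: measurable_cong_sets[OF \<mu>s[OF m] refl])
    then show "(\<integral>\<^sup>+y. emeasure (q y) (D m) \<partial>\<mu> m) = ennreal (1 - measure (\<mu> m \<bind> q) (space Z - D m))"
      using q.prob_compl[of "D m"] D[OF m] sq sets_eq_imp_space_eq[OF sq] by (simp add: q.emeasure_eq_measure)
    show "emeasure (\<mu> m) (D' m) = ennreal (1 - measure (\<mu> m) (space Y - D' m))"
      using prob_compl[of "D' m"] D'(1) m \<mu>s[OF m] sets_eq_imp_space_eq[OF \<mu>s[OF m]] by (simp add: emeasure_eq_measure)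
    show "measure (\<mu> m \<bind> q) (space Z - D m) \<le> 1" "measure (\<mu> m) (space Y - D' m) \<le> 1"
      by simp_all
  qed
  have "ennreal (\<Sum>m<M. 1 - measure (\<mu> m \<bind> q) (space Z - D m)) \<le> ennreal (\<Sum>m<M. 1 - measure (\<mu> m) (space Y - D' m))"
  proof (subst (1 2) sum_ennreal[symmetric])
    show "(\<Sum>m<M. ennreal (1 - measure (\<mu> m \<bind> q) (space Z - D m)))
      \<le> (\<Sum>m<M. ennreal (1 - measure (\<mu> m) (space Y - D' m)))"
      using le by (simp add: 1 2)
  qed (use 3 in auto)
  then have "(\<Sum>m<M. 1 - measure (\<mu> m \<bind> q) (space Z - D m)) \<le> (\<Sum>m<M. 1 - measure (\<mu> m) (space Y - D' m))"
    using 3 by (subst (asm) ennreal_le_iff) (auto intro!: sum_nonneg)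
  with D' show ?thesis by (auto simp: sum_subtractf)
qed

section \<open>Degraded compound channels\<close>

text \<open>The degradation identity is given only on the block space, and the joint and output laws
  see only words of that space.\<close>

lemma joint_law_cong:
  assumes P: "P \<in> space (prob_algebra X)" and eq: "\<And>x. x \<in> space X \<Longrightarrow> K x = K' x"
  shows "joint_law X Y K P = joint_law X Y K' P" "P \<bind> K = P \<bind> K'"
proof -
  have "space P = space X" using P by (auto simp: space_prob_algebra dest: sets_eq_imp_space_eq)
  then show "joint_law X Y K P = joint_law X Y K' P" "P \<bind> K = P \<bind> K'"
    using eq by (auto simp: joint_law_def intro!: bind_cong)
qed

lemma (in channel_input) low_mono: "t \<le> t' \<Longrightarrow> low t \<subseteq> low t'"
  by (auto simp: low_def intro: order_trans)

text \<open>Allows an arbitrarily small loss \<open>\<delta>\<close> of rate, in exchange for which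
  an error term decays exponentially.\<close>

lemma ereal_le_if_diff_le:
  assumes "\<And>\<delta>. \<delta> > 0 \<Longrightarrow> ereal (R - \<delta>) \<le> C"
  shows "ereal R \<le> C"
proof (rule ereal_le_epsilon2)
  fix e :: real assume "0 < e"
  then show "ereal R \<le> C + ereal e"
    using add_right_mono[OF assms[of e], of "ereal e"] by simp
qed

context compound_channel
begin

section \<open>Error probabilities and information rates by blocklength\<close>

lemma channel_input_state:
  assumes "P \<in> inputs A" "s \<in> S" "n \<ge> 1"
  shows "channel_input (block A n) (block B n) (W s n) (P n)"
  using assms kernel by (simp add: channel_input_def inputs_def)

lemma prob_Z_le_eq:
  assumes "P \<in> inputs A" "s \<in> S" "n \<ge> 1"
  shows "prob_Z_le A B W P s n R = measure (joint_law (block A n) (block B n) (W s n) (P n))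
    (channel_input.low (block A n) (block B n) (W s n) (P n) (real n * R))"
proof -
  interpret channel_input "block A n" "block B n" "W s n" "P n"
    by (rule channel_input_state) fact+
  have "i / ereal (real n) \<le> ereal R \<longleftrightarrow> i \<le> ereal (real n * R)" for i :: ereal
    using assms(3) by (cases i) (auto simp: field_simps)
  then show ?thesis by (simp add: prob_Z_le_def low_def)
qed

lemma prob_Z_le_bounds:
  assumes "P \<in> inputs A" "s \<in> S" "n \<ge> 1"
  shows "0 \<le> prob_Z_le A B W P s n R" "prob_Z_le A B W P s n R \<le> 1"
proof -
  interpret channel_input "block A n" "block B n" "W s n" "P n"
    by (rule channel_input_state) fact+
  show "0 \<le> prob_Z_le A B W P s n R" "prob_Z_le A B W P s n R \<le> 1"
    using assms prob_space.prob_le_1[OF prob_J] by (simp_all add: prob_Z_le_eq)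
qed

lemma prob_Z_le_le_SUP:
  assumes "P \<in> inputs A" "s \<in> S" "n \<ge> 1"
  shows "prob_Z_le A B W P s n R \<le> (SUP s\<in>S. prob_Z_le A B W P s n R)"
  using assms prob_Z_le_bounds[of P _ n R] by (intro cSUP_upper bdd_aboveI2[where M=1]) auto

lemma compound_inf_info_rate_le:
  assumes inp: "P \<in> inputs A" and s: "s \<in> S"
  shows "compound_inf_info_rate A B S W P \<le> inf_info_rate A B W P s"
  unfolding compound_inf_info_rate_def inf_info_rate_def
proof (intro Sup_subset_mono image_mono subsetI CollectI)
  fix R assume "R \<in> {R. (\<lambda>n. SUP s\<in>S. prob_Z_le A B W P s n R) \<longlonglongrightarrow> 0}"
  then have R: "(\<lambda>n. SUP s\<in>S. prob_Z_le A B W P s n R) \<longlonglongrightarrow> 0" by simp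
  show "(\<lambda>n. prob_Z_le A B W P s n R) \<longlonglongrightarrow> 0"
    by (rule tendsto_sandwich[OF _ _ tendsto_const R])
      \<comment> \<open>Kernels and input laws are constrained only from blocklength 1 on, so the
        bounds hold eventually rather than for all \<open>n\<close>.\<close>
      (auto intro!: eventually_sequentiallyI[of 1] prob_Z_le_bounds prob_Z_le_le_SUP inp s)
qed

lemma error_prob_bounds:
  assumes "is_code A B S n M c D" "s \<in> S" "n \<ge> 1"
  shows "0 \<le> error_prob B W s n M c D" "error_prob B W s n M c D \<le> 1"
proof -
  have "measure (W s n (c m)) (space (block B n) - D s m) \<le> 1" if "m < M" for m
    using measurable_space[OF kernel[OF assms(2,3)], of "c m"] assms(1) that
    by (intro prob_space.prob_le_1) (auto simp: is_code_def space_prob_algebra)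
  then have "(\<Sum>m<M. measure (W s n (c m)) (space (block B n) - D s m)) \<le> (\<Sum>m<M. 1)"
    by (intro sum_mono) auto
  then show "0 \<le> error_prob B W s n M c D" "error_prob B W s n M c D \<le> 1"
    using assms(1) by (auto simp: error_prob_def is_code_def sum_nonneg divide_le_eq_1)
qed

lemma exp_minus_n_tendsto_0: "\<delta> > 0 \<Longrightarrow> (\<lambda>n. exp (- (real n * \<delta>))) \<longlonglongrightarrow> 0"
  using LIMSEQ_power_zero[of "exp (- \<delta>)"] by (simp flip: exp_of_nat_mult)

section \<open>Converse for a single state\<close>

text \<open>Inputs uniform on the codewords of the given codes have inf-information rate at least
  \<open>R - \<delta>\<close> under \<open>s\<close>: the probability of low density is at most the
  error in state \<open>s\<close> plus a vanishing term.\<close>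

lemma achievable_le_single_state:
  assumes R: "achievable A B S W R" and s: "s \<in> S"
  shows "ereal R \<le> (SUP P\<in>inputs A. inf_info_rate A B W P s)"
proof (rule ereal_le_if_diff_le)
  fix \<delta> :: real assume \<delta>: "\<delta> > 0"
  from R obtain M c D where
    code: "\<And>n. n \<ge> 1 \<Longrightarrow> is_code A B S n (M n) (c n) (D n)"
    and rate: "ereal R \<le> liminf (\<lambda>n. ereal (ln (real (M n)) / real n))"
    and err: "(\<lambda>n. SUP s\<in>S. error_prob B W s n (M n) (c n) (D n)) \<longlonglongrightarrow> 0"
    by (auto simp: achievable_def)
  define P where "P = (\<lambda>n. uniform_input (block A n) (M n) (c n))"
  have inp: "P \<in> inputs A"
    using code by (auto simp: inputs_def P_def is_code_def intro!: uniform_input_in_prob_algebra)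
  \<comment> \<open>One half of \<open>\<delta>\<close> pays for passing from the liminf to all
    large \<open>n\<close>, the other half makes \<open>exp (n * (R - \<delta>)) / M n\<close> decay
    exponentially.\<close>
  have "ereal (R - \<delta> / 2) < liminf (\<lambda>n. ereal (ln (real (M n)) / real n))"
    by (rule less_le_trans[OF _ rate]) (use \<delta> in simp)
  then have ev: "\<forall>\<^sub>F n in sequentially. R - \<delta> / 2 < ln (real (M n)) / real n"
    using less_LiminfD by fastforce
  have "(\<lambda>n. prob_Z_le A B W P s n (R - \<delta>)) \<longlonglongrightarrow> 0"
  proof (rule tendsto_sandwich[OF _ _ tendsto_const])
    show "\<forall>\<^sub>F n in sequentially. 0 \<le> prob_Z_le A B W P s n (R - \<delta>)"
      by (auto intro!: eventually_sequentiallyI[of 1] prob_Z_le_bounds inp s)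
    show "\<forall>\<^sub>F n in sequentially. prob_Z_le A B W P s n (R - \<delta>)
      \<le> (SUP s\<in>S. error_prob B W s n (M n) (c n) (D n)) + exp (- (real n * (\<delta> / 2)))"
      using ev eventually_ge_at_top[of 1]
    proof eventually_elim
      case (elim n)
      then have n: "n \<ge> 1" by simp
      from code[OF n] s have M: "M n \<ge> 1" and c: "\<And>m. m < M n \<Longrightarrow> c n m \<in> space (block A n)"
        and D: "\<And>m. m < M n \<Longrightarrow> D n s m \<in> sets (block B n)" and disj: "disjoint_family_on (D n s) {..<M n}"
        by (auto simp: is_code_def)
      have "prob_Z_le A B W P s n (R - \<delta>) \<le> error_prob B W s n (M n) (c n) (D n) + exp (real n * (R - \<delta>)) / real (M n)"
        unfolding prob_Z_le_eq[OF inp s n] unfolding error_prob_def P_def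
        by (rule verdu_han[where c="c n" and D="D n s", OF M c kernel[OF s n] D disj])
      moreover have "error_prob B W s n (M n) (c n) (D n) \<le> (SUP s\<in>S. error_prob B W s n (M n) (c n) (D n))"
        using error_prob_bounds[OF code[OF n] _ n] s by (intro cSUP_upper bdd_aboveI2[where M=1]) auto
      moreover have "exp (real n * (R - \<delta>)) / real (M n) \<le> exp (- (real n * (\<delta> / 2)))"
      proof -
        have "real n * (R - \<delta> / 2) \<le> ln (real (M n))"
          using elim n by (simp add: field_simps)
        then have "exp (real n * (R - \<delta> / 2)) \<le> real (M n)"
          using M by (simp add: ln_ge_iff)
        then have "exp (real n * (R - \<delta>)) / real (M n) \<le> exp (real n * (R - \<delta>)) / exp (real n * (R - \<delta> / 2))"
          using M by (intro divide_left_mono) auto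
        also have "\<dots> = exp (- (real n * (\<delta> / 2)))"
          by (simp add: field_simps flip: exp_diff)
        finally show ?thesis .
      qed
      ultimately show ?case by linarith
    qed
    show "(\<lambda>n. (SUP s\<in>S. error_prob B W s n (M n) (c n) (D n)) + exp (- (real n * (\<delta> / 2)))) \<longlonglongrightarrow> 0"
      using tendsto_add[OF err exp_minus_n_tendsto_0[of "\<delta> / 2"]] \<delta> by simp
  qed
  then have "ereal (R - \<delta>) \<le> inf_info_rate A B W P s"
    unfolding inf_info_rate_def by (intro Sup_upper) auto
  also have "\<dots> \<le> (SUP P\<in>inputs A. inf_info_rate A B W P s)"
    by (rule SUP_upper) (rule inp)
  finally show "ereal (R - \<delta>) \<le> (SUP P\<in>inputs A. inf_info_rate A B W P s)" .
qed

section \<open>Information rates against the degraded state\<close>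

text \<open>The matrix of the existential in \<open>degraded\<close>, so that the witness
  \<open>sw\<close> can be fixed.\<close>

definition degraded_state :: "'s \<Rightarrow> bool" where
  "degraded_state sw \<longleftrightarrow> sw \<in> S \<and> (\<forall>s\<in>S - {sw}. \<forall>n\<ge>1.
        \<exists>q \<in> block B n \<rightarrow>\<^sub>M prob_algebra (block B n).
          \<forall>x\<in>space (block A n). W sw n x = W s n x \<bind> q)"

lemma prob_Z_le_degraded:
  assumes sw: "degraded_state sw" and inp: "P \<in> inputs A" and s: "s \<in> S" and n: "n \<ge> 1" and \<delta>: "\<delta> > 0"
  shows "prob_Z_le A B W P s n (R - \<delta>) \<le> prob_Z_le A B W P sw n R + exp (- (real n * \<delta>))"
proof (cases "s = sw")
  \<comment> \<open>No degrading channel is supplied for \<open>sw\<close> itself; here lowering the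
    threshold is enough.\<close>
  case True
  interpret channel_input "block A n" "block B n" "W s n" "P n"
    by (rule channel_input_state) fact+
  interpret prob_space J by (rule prob_J)
  have "measure J (low (real n * (R - \<delta>))) \<le> measure J (low (real n * R))"
    using \<delta> by (intro finite_measure_mono low_mono) (auto simp: mult_left_mono)
  then have "prob_Z_le A B W P s n (R - \<delta>) \<le> prob_Z_le A B W P s n R"
    by (simp only: prob_Z_le_eq[OF inp s n])
  then show ?thesis using True by (simp add: add_increasing2)
next
  case False
  have sws: "sw \<in> S" using sw by (simp add: degraded_state_def)
  have "\<exists>q \<in> block B n \<rightarrow>\<^sub>M prob_algebra (block B n).
      \<forall>x\<in>space (block A n). W sw n x = W s n x \<bind> q"
    using sw s n False unfolding degraded_state_def by blast
  then obtain q where q: "q \<in> block B n \<rightarrow>\<^sub>M prob_algebra (block B n)"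
    and Wq: "\<And>x. x \<in> space (block A n) \<Longrightarrow> W sw n x = W s n x \<bind> q"
    by blast
  interpret channel_input "block A n" "block B n" "W s n" "P n"
    by (rule channel_input_state) fact+
  interpret w: channel_input "block A n" "block B n" "W sw n" "P n"
    by (rule channel_input_state) fact+
  interpret wq: channel_input "block A n" "block B n" "\<lambda>x. W s n x \<bind> q" "P n"
    by standard (rule w.P, rule measurable_bind_prob_space[OF K q])
  note cong = joint_law_cong[OF w.P Wq]
  have "w.low t = wq.low t" for t
    by (simp add: w.low_def wq.low_def info_density_def cong)
  then show ?thesis
    using measure_low_bind_le[OF q, of "real n * (R - \<delta>)" "real n * R"] cong
    by (simp add: prob_Z_le_eq[OF inp s n] prob_Z_le_eq[OF inp sws n] algebra_simps)
qed

text \<open>The bound of \<open>prob_Z_le_degraded\<close> does not depend on \<open>s\<close>, so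
  it passes to the supremum over the states.\<close>

lemma inf_info_rate_le_compound:
  assumes sw: "degraded_state sw" and inp: "P \<in> inputs A"
  shows "inf_info_rate A B W P sw \<le> compound_inf_info_rate A B S W P"
  unfolding inf_info_rate_def
proof (rule Sup_least, clarify)
  fix R assume R: "(\<lambda>n. prob_Z_le A B W P sw n R) \<longlonglongrightarrow> 0"
  show "ereal R \<le> compound_inf_info_rate A B S W P"
  proof (rule ereal_le_if_diff_le)
    fix \<delta> :: real assume \<delta>: "\<delta> > 0"
    have "(\<lambda>n. SUP s\<in>S. prob_Z_le A B W P s n (R - \<delta>)) \<longlonglongrightarrow> 0"
    proof (rule tendsto_sandwich[OF _ _ tendsto_const])
      obtain s where s: "s \<in> S" using states_nonempty by auto
      show "\<forall>\<^sub>F n in sequentially. 0 \<le> (SUP s\<in>S. prob_Z_le A B W P s n (R - \<delta>))"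
        by (rule eventually_sequentiallyI[of 1])
          (rule order_trans[OF prob_Z_le_bounds(1)[OF inp s] prob_Z_le_le_SUP[OF inp s]])
      show "\<forall>\<^sub>F n in sequentially. (SUP s\<in>S. prob_Z_le A B W P s n (R - \<delta>))
          \<le> prob_Z_le A B W P sw n R + exp (- (real n * \<delta>))"
        by (rule eventually_sequentiallyI[of 1])
          (use states_nonempty prob_Z_le_degraded[OF sw inp _ _ \<delta>] in \<open>auto intro!: cSUP_least\<close>)
      show "(\<lambda>n. prob_Z_le A B W P sw n R + exp (- (real n * \<delta>))) \<longlonglongrightarrow> 0"
        using tendsto_add[OF R exp_minus_n_tendsto_0[OF \<delta>]] by simp
    qed
    then show "ereal (R - \<delta>) \<le> compound_inf_info_rate A B S W P"
      unfolding compound_inf_info_rate_def by (intro Sup_upper) auto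
  qed
qed

section \<open>Codes serving all states\<close>

text \<open>The codewords stay fixed, as the transmitter does not know the state; only the decision
  regions are chosen anew for each \<open>s\<close>, by \<open>degraded_decoding\<close>.\<close>

lemma code_for_degraded_state:
  assumes sw: "degraded_state sw" and n: "n \<ge> 1" and M: "M \<ge> 1"
    and c: "\<And>m. m < M \<Longrightarrow> c m \<in> space (block A n)"
    and D: "\<And>m. m < M \<Longrightarrow> D m \<in> sets (block B n)" "disjoint_family_on D {..<M}"
  shows "\<exists>D'. is_code A B S n M c D' \<and> (\<forall>s\<in>S. error_prob B W s n M c D'
    \<le> (\<Sum>m<M. measure (W sw n (c m)) (space (block B n) - D m)) / real M)"
proof -
  have good: "\<exists>E. (\<forall>m<M. E m \<in> sets (block B n)) \<and> disjoint_family_on E {..<M} \<and>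
    (\<Sum>m<M. measure (W s n (c m)) (space (block B n) - E m))
      \<le> (\<Sum>m<M. measure (W sw n (c m)) (space (block B n) - D m))"
    (is "\<exists>E. ?good s E") if s: "s \<in> S" for s
  proof (cases "s = sw")
    case True
    then show ?thesis using D by (intro exI[of _ D]) auto
  next
    case False
    have "\<exists>q \<in> block B n \<rightarrow>\<^sub>M prob_algebra (block B n).
      \<forall>x\<in>space (block A n). W sw n x = W s n x \<bind> q"
      using sw s n False unfolding degraded_state_def by blast
    then obtain q where q: "q \<in> block B n \<rightarrow>\<^sub>M prob_algebra (block B n)"
      and Wq: "\<And>x. x \<in> space (block A n) \<Longrightarrow> W sw n x = W s n x \<bind> q"
      by blast
    have "W s n (c m) \<in> space (prob_algebra (block B n))" if "m < M" for m
      by (rule measurable_space[OF kernel[OF s n] c[OF that]])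
    from degraded_decoding[OF q M this D] show ?thesis
      using Wq c by simp
  qed
  have "\<forall>s\<in>S. \<exists>E. ?good s E" by (intro ballI good)
  from bchoice[OF this] obtain D' where D': "\<forall>s\<in>S. ?good s (D' s)" by blast
  then show ?thesis
    using M c by (intro exI[of _ D']) (auto simp: is_code_def error_prob_def divide_right_mono)
qed

lemma degraded_codes_exist:
  assumes sw: "degraded_state sw" and inp: "P \<in> inputs A" and n: "n \<ge> 1" and M: "M \<ge> 1"
  shows "\<exists>c D. is_code A B S n M c D \<and> (\<forall>s\<in>S. error_prob B W s n M c D
    \<le> prob_Z_le A B W P sw n R + real M * exp (- (real n * R)))"
proof -
  have sws: "sw \<in> S" using sw by (simp add: degraded_state_def)
  interpret channel_input "block A n" "block B n" "W sw n" "P n"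
    by (rule channel_input_state) fact+
  let ?e = "prob_Z_le A B W P sw n R + real M * exp (- (real n * R))"
  from feinstein[of M M "real n * R"] obtain c D where
    c: "\<And>m. m < M \<Longrightarrow> c m \<in> space (block A n)"
    and D: "\<And>m. m < M \<Longrightarrow> D m \<in> sets (block B n)" "disjoint_family_on D {..<M}"
    and e: "\<And>m. m < M \<Longrightarrow> measure (W sw n (c m)) (space (block B n) - D m) \<le> ?e"
    unfolding prob_Z_le_eq[OF inp sws n] by blast
  have "(\<Sum>m<M. measure (W sw n (c m)) (space (block B n) - D m)) \<le> (\<Sum>m<M. ?e)"
    by (intro sum_mono e) simp
  then have "(\<Sum>m<M. measure (W sw n (c m)) (space (block B n) - D m)) / real M \<le> ?e"
    using M by (simp add: divide_le_eq mult.commute)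
  moreover obtain D' where "is_code A B S n M c D'" "\<forall>s\<in>S. error_prob B W s n M c D'
      \<le> (\<Sum>m<M. measure (W sw n (c m)) (space (block B n) - D m)) / real M"
    using code_for_degraded_state[where c=c and D=D, OF sw n M c D] by blast
  ultimately show ?thesis
    by (intro exI[of _ c] exI[of _ D'] conjI ballI) (blast intro: order_trans)+
qed

text \<open>A bound \<open>e n\<close> common to all states controls the supremum of the errors, so
  it suffices to choose one code per blocklength.\<close>

lemma achievable_of_code_sizes:
  assumes codes: "\<And>n. n \<ge> 1 \<Longrightarrow> \<exists>c D. is_code A B S n (M n) c D \<and> (\<forall>s\<in>S. error_prob B W s n (M n) c D \<le> e n)"
    and rate: "\<And>n. n \<ge> 1 \<Longrightarrow> R \<le> ln (real (M n)) / real n" and e: "e \<longlonglongrightarrow> 0"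
  shows "achievable A B S W R"
proof -
  from codes obtain c D where code: "\<And>n. n \<ge> 1 \<Longrightarrow> is_code A B S n (M n) (c n) (D n)"
    and err: "\<And>n s. n \<ge> 1 \<Longrightarrow> s \<in> S \<Longrightarrow> error_prob B W s n (M n) (c n) (D n) \<le> e n"
    by metis
  obtain s where s: "s \<in> S" using states_nonempty by auto
  have "(\<lambda>n. SUP s\<in>S. error_prob B W s n (M n) (c n) (D n)) \<longlonglongrightarrow> 0"
  proof (rule tendsto_sandwich[OF _ _ tendsto_const e])
    show "\<forall>\<^sub>F n in sequentially. 0 \<le> (SUP s\<in>S. error_prob B W s n (M n) (c n) (D n))"
    proof (rule eventually_sequentiallyI[of 1])
      fix n :: nat assume n: "1 \<le> n"
      show "0 \<le> (SUP s\<in>S. error_prob B W s n (M n) (c n) (D n))"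
        by (rule cSUP_upper2[OF _ s]) (use error_prob_bounds[OF code[OF n] _ n] s in \<open>auto intro!: bdd_aboveI2[where M=1]\<close>)
    qed
    show "\<forall>\<^sub>F n in sequentially. (SUP s\<in>S. error_prob B W s n (M n) (c n) (D n)) \<le> e n"
      by (rule eventually_sequentiallyI[of 1]) (use states_nonempty err in \<open>auto intro!: cSUP_least\<close>)
  qed
  moreover have "ereal R \<le> liminf (\<lambda>n. ereal (ln (real (M n)) / real n))"
    by (rule Liminf_bounded) (use rate in \<open>auto intro!: eventually_sequentiallyI[of 1]\<close>)
  ultimately show ?thesis using code by (auto simp: achievable_def)
qed

text \<open>A single message, decoded whatever the output, never fails and has rate 0.\<close>

lemma achievable_nonpos: "R \<le> 0 \<Longrightarrow> achievable A B S W R"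
proof (rule achievable_of_code_sizes[where M="\<lambda>_. 1" and e="\<lambda>_. 0"])
  fix n :: nat
  have "space (block A n) \<noteq> {}"
    using input_alphabet_nonempty by (auto simp: block_def space_PiM PiE_eq_empty_iff)
  then obtain x where "x \<in> space (block A n)" by auto
  then show "\<exists>c D. is_code A B S n 1 c D \<and> (\<forall>s\<in>S. error_prob B W s n 1 c D \<le> 0)"
    by (intro exI[of _ "\<lambda>_. x"] exI[of _ "\<lambda>_ _. space (block B n)"])
      (auto simp: is_code_def error_prob_def disjoint_family_on_def)
qed (auto simp: divide_nonpos_nonneg)

text \<open>Codes of rate about \<open>R - \<delta>\<close> are built with density threshold
  \<open>R\<close>; the gap makes the term \<open>M * exp (- n * R)\<close> of Feinstein's bound
  vanish.\<close>

lemma inf_info_rate_le_compound_capacity: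
  assumes sw: "degraded_state sw" and inp: "P \<in> inputs A"
  shows "inf_info_rate A B W P sw \<le> compound_capacity A B S W"
  unfolding inf_info_rate_def
proof (rule Sup_least, clarify)
  fix R assume R: "(\<lambda>n. prob_Z_le A B W P sw n R) \<longlonglongrightarrow> 0"
  have "achievable A B S W (R - \<delta>)" if \<delta>: "\<delta> > 0" for \<delta>
  proof (cases "R \<le> 0")
    case True
    with \<delta> show ?thesis by (intro achievable_nonpos) simp
  next
    case False
    \<comment> \<open>Rounding up secures the rate but adds up to one codeword, hence the error term
      \<open>exp (- n * R)\<close>. It vanishes only for \<open>R > 0\<close>, which is why
      nonpositive rates are treated separately.\<close>
    define M where "M = (\<lambda>n::nat. nat \<lceil>exp (real n * (R - \<delta>))\<rceil>)"
    have M1: "M n \<ge> 1" for n by (simp add: M_def Suc_le_eq)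
    have Mge: "exp (real n * (R - \<delta>)) \<le> real (M n)" for n
      unfolding M_def by linarith
    have Mle: "real (M n) \<le> exp (real n * (R - \<delta>)) + 1" for n
      unfolding M_def using exp_gt_zero[of "real n * (R - \<delta>)"] by linarith
    show ?thesis
    proof (rule achievable_of_code_sizes[where M=M and
          e="\<lambda>n. prob_Z_le A B W P sw n R + (exp (- (real n * \<delta>)) + exp (- (real n * R)))"])
      fix n :: nat assume n: "n \<ge> 1"
      have "real (M n) * exp (- (real n * R)) \<le> (exp (real n * (R - \<delta>)) + 1) * exp (- (real n * R))"
        by (intro mult_right_mono Mle) simp
      also have "\<dots> = exp (- (real n * \<delta>)) + exp (- (real n * R))"
        by (simp add: algebra_simps flip: exp_add)
      finally show "\<exists>c D. is_code A B S n (M n) c D \<and> (\<forall>s\<in>S. error_prob B W s n (M n) c D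
          \<le> prob_Z_le A B W P sw n R + (exp (- (real n * \<delta>)) + exp (- (real n * R))))"
        using degraded_codes_exist[OF sw inp n M1[of n], of R]
        by (meson add_left_mono order_trans)
      have "real n * (R - \<delta>) \<le> ln (real (M n))"
        using Mge[of n] M1[of n] by (simp add: ln_ge_iff)
      then show "R - \<delta> \<le> ln (real (M n)) / real n"
        using n by (simp add: field_simps)
    next
      have "(\<lambda>n. prob_Z_le A B W P sw n R + (exp (- (real n * \<delta>)) + exp (- (real n * R)))) \<longlonglongrightarrow> 0 + (0 + 0)"
        using False \<delta> by (intro tendsto_add R exp_minus_n_tendsto_0) auto
      then show "(\<lambda>n. prob_Z_le A B W P sw n R + (exp (- (real n * \<delta>)) + exp (- (real n * R)))) \<longlonglongrightarrow> 0"
        by simp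
    qed
  qed
  then show "ereal R \<le> compound_capacity A B S W"
    unfolding compound_capacity_def
    by (intro ereal_le_if_diff_le[of R "Sup (ereal ` {R. achievable A B S W R})"] Sup_upper imageI) simp
qed

end

section \<open>Equality of the capacities\<close>

theorem proposition5:
  fixes A :: "'a measure" and B :: "'b measure" and S :: "'s set"
    and W :: "'s \<Rightarrow> nat \<Rightarrow> (nat \<Rightarrow> 'a) \<Rightarrow> (nat \<Rightarrow> 'b) measure"
  assumes "compound_channel A B S W"
    and "degraded A B S W"
  shows "worst_case_capacity A B S W = (INF s\<in>S. SUP P\<in>inputs A. inf_info_rate A B W P s)
       \<and> (INF s\<in>S. SUP P\<in>inputs A. inf_info_rate A B W P s)
           = (SUP P\<in>inputs A. compound_inf_info_rate A B S W P)
       \<and> (SUP P\<in>inputs A. compound_inf_info_rate A B S W P) = compound_capacity A B S W"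
proof -
  interpret compound_channel A B S W by fact
  obtain sw where sw: "degraded_state sw"
    using assms(2) unfolding degraded_def degraded_state_def by blast
  then have sws: "sw \<in> S" by (simp add: degraded_state_def)
  let ?C = "SUP P\<in>inputs A. inf_info_rate A B W P sw"
  let ?w = "INF s\<in>S. SUP P\<in>inputs A. inf_info_rate A B W P s"
  let ?c = "SUP P\<in>inputs A. compound_inf_info_rate A B S W P"
  \<comment> \<open>The cycle \<open>?w \<le> ?C \<le> ?c \<le> ?w\<close>; only the middle
    inequality uses degradedness beyond \<open>sw \<in> S\<close>.\<close>
  have *: "?w \<le> ?C" using sws by (rule INF_lower)
  have **: "?C \<le> ?c"
    using inf_info_rate_le_compound[OF sw] by (intro SUP_mono) auto
  have ***: "?c \<le> ?w"
    using compound_inf_info_rate_le by (intro INF_greatest SUP_mono) auto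
  \<comment> \<open>The compound capacity is compared with \<open>?C\<close> directly, so its
    formula as the supremum of compound inf-information rates comes out as a consequence.\<close>
  have "?C \<le> compound_capacity A B S W"
    using inf_info_rate_le_compound_capacity[OF sw] by (intro SUP_least)
  moreover have "compound_capacity A B S W \<le> ?C"
    unfolding compound_capacity_def using achievable_le_single_state[OF _ sws] by (auto intro!: Sup_least)
  moreover have "?w = ?c" using order_trans[OF * **] *** by (rule antisym)
  moreover have "?c = ?C" using order_trans[OF *** *] ** by (rule antisym)
  ultimately show ?thesis
    by (simp add: worst_case_capacity_def)
qed

end
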